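(* Let $\mathcal{C}:\mathcal{P}(\mathbb{R}^n)\to[0,\infty]$ be an outer capacity which satisfies the packing assumption (P) and is doubling. (i) There exists a constant $C>0$ such that for every $f:\mathbb{R}^n\to\mathbb{R}$ and every $t>0$, $$\mathcal{C}\left(\{x\in\mathbb{R}^n:\mathcal{M}_{\mathcal{C}}f(x)>t\}\right)\le\frac{C}{t}\int_{\mathbb{R}^n}|f|\,d\mathcal{C}.$$ (ii) If $1<p<\infty$, then there exists a constant $C>0$ such that for every $f:\mathbb{R}^n\to\mathbb{R}$, $$\int_{\mathbb{R}^n}(\mathcal{M}_{\mathcal{C}}f)^p\,d\mathcal{C}\le C\int_{\mathbb{R}^n}|f|^p\,d\mathcal{C}.$$
   Context: Outer capacity: a set function $\mathcal{C}:\mathcal{P}(\mathbb{R}^n)\to[0,\infty]$ (where $\mathcal{P}(\mathbb{R}^n)$ is the set of all subsets of $\mathbb{R}^n$) with $\mathcal{C}(\emptyset)=0$; $A\subset B\Rightarrow\mathcal{C}(A)\le\mathcal{C}(B)$; $A\subset\bigcup_{i=1}^\infty A_i\Rightarrow\mathcal{C}(A)\le\sum_i\mathcal{C}(A_i)$; and $\mathcal{C}(A)=\inf\{\mathcal{C}(U): A\subset U,\ U\text{ open}\}$. Doubling: there is a universal constant $D_0>0$ with $\mathcal{C}(B(x,2r))\le D_0\,\mathcal{C}(B(x,r))$ for all $x\in\mathbb{R}^n$, $r>0$, where $B(x,r)$ is the open ball. Dyadic cubes. Fix a half-open cube $Q=[x_1,x_1+\ell)\times\cdots\times[x_n,x_n+\ell)\subset\mathbb{R}^n$,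 $\ell>0$, and put $x_Q=(x_1,\dots,x_n)$. Let $\mathcal{D}_0(Q)=\{x_Q+2^k\ell(m+[0,1)^n): k\in\mathbb{Z}, m\in\mathbb{Z}^n\}$ and $\mathcal{D}(Q)=\mathcal{D}_0(Q)\cup\{\prod_{i=1}^n I_i: I_i=[x_i,\infty)\text{ or }(-\infty,x_i)\}$. Choquet integral: $\int_A f\,d\mathcal{C}=\int_0^\infty\mathcal{C}(\{x\in A: f(x)>t\})\,dt$ for $f\ge0$. Convention: $0\cdot\infty=0$, and an average over a set of zero capacity is $0$. Packing assumption (P): there exists a constant $A_0\ge1$ such that for every $Q'\in\mathcal{D}(Q)$ and every non-overlapping collection $\{Q_j\}$ of cubes of $\mathcal{D}(Q)$ with $Q_j\subset Q'$ for all $j$ which satisfies $\sum_{Q_j\subset Q'}\mathcal{C}(Q_j)\le A_0\,\mathcal{C}(Q')$, one has $\sum_j\int_{Q_j}f\,d\mathcal{C}\le A_0\int_{\cup_jQ_j}f\,d\mathcal{C}$ for every function $f:\mathbb{R}^n\to[0,\infty]$. Maximal function: $\mathcal{M}_{\mathcal{C}}f(x)=\sup_{r>0}\frac{1}{\mathcal{C}(B(x,r))}\int_{B(x,r)}|f|\,d\mathcal{C}$. *)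

theory Defs
  imports "HOL-Analysis.Analysis"
begin

definition outer_capacity :: "((real ^ 'n) set \<Rightarrow> ennreal) \<Rightarrow> bool" where
  "outer_capacity C \<longleftrightarrow>
     C {} = 0 \<and>
     (\<forall>A B. A \<subseteq> B \<longrightarrow> C A \<le> C B) \<and>
     (\<forall>A (S :: nat \<Rightarrow> (real ^ 'n) set). A \<subseteq> (\<Union>i. S i) \<longrightarrow> C A \<le> (\<Sum>i. C (S i))) \<and>
     (\<forall>A. C A = (INF U \<in> {U. open U \<and> A \<subseteq> U}. C U))"

definition doubling_capacity :: "((real ^ 'n) set \<Rightarrow> ennreal) \<Rightarrow> bool" where
  "doubling_capacity C \<longleftrightarrow>
     (\<exists>D0::real. D0 > 0 \<and> (\<forall>x r. r > 0 \<longrightarrow> C (ball x (2 * r)) \<le> ennreal D0 * C (ball x r)))"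

text \<open>The half-open cube is given by its lower corner \<open>xQ\<close> and its side length \<open>l\<close>.\<close>

definition dyadic_cubes0 :: "real ^ 'n \<Rightarrow> real \<Rightarrow> (real ^ 'n) set set" where
  "dyadic_cubes0 xQ l =
     {(\<lambda>y. xQ + (2 powi k * l) *\<^sub>R (m + y)) ` {y. \<forall>i. 0 \<le> y $ i \<and> y $ i < 1} | k m.
        \<forall>i. m $ i \<in> \<int>}"

definition orthants :: "real ^ 'n \<Rightarrow> (real ^ 'n) set set" where
  "orthants xQ =
     {{y. \<forall>i. y $ i \<in> I i} | I. \<forall>i. I i = {xQ $ i..} \<or> I i = {..<xQ $ i}}"

definition dyadic_cubes :: "real ^ 'n \<Rightarrow> real \<Rightarrow> (real ^ 'n) set set" where
  "dyadic_cubes xQ l = dyadic_cubes0 xQ l \<union> orthants xQ"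

text \<open>No measurability is needed: the integrand is nonincreasing in \<open>t\<close>, hence Borel.\<close>

definition choquet_integral ::
  "((real ^ 'n) set \<Rightarrow> ennreal) \<Rightarrow> (real ^ 'n) set \<Rightarrow> (real ^ 'n \<Rightarrow> ennreal) \<Rightarrow> ennreal" where
  "choquet_integral C A f = (\<integral>\<^sup>+ t \<in> {0<..}. C {x \<in> A. f x > ennreal t} \<partial>lborel)"

definition non_overlapping :: "(real ^ 'n) set set \<Rightarrow> bool" where
  "non_overlapping F \<longleftrightarrow> pairwise (\<lambda>R S. interior R \<inter> interior S = {}) F"

text \<open>Collections of cubes are automatically countable, and every family in \<^typ>\<open>ennreal\<close> is
  summable, so the unordered sums below are the expected ones.\<close>

definition packing_assumption ::
  "real ^ 'n \<Rightarrow> real \<Rightarrow> ((real ^ 'n) set \<Rightarrow> ennreal) \<Rightarrow> bool" where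
  "packing_assumption xQ l C \<longleftrightarrow>
     (\<exists>A0::real. A0 \<ge> 1 \<and>
        (\<forall>Q' \<in> dyadic_cubes xQ l. \<forall>F. F \<subseteq> dyadic_cubes xQ l \<and> non_overlapping F \<and>
             (\<forall>R \<in> F. R \<subseteq> Q') \<and> (\<Sum>\<^sub>\<infinity>R\<in>F. C R) \<le> ennreal A0 * C Q' \<longrightarrow>
           (\<forall>f :: real ^ 'n \<Rightarrow> ennreal.
              (\<Sum>\<^sub>\<infinity>R\<in>F. choquet_integral C R f) \<le> ennreal A0 * choquet_integral C (\<Union>F) f)))"

text \<open>Division in \<^typ>\<open>ennreal\<close> is multiplication by the inverse, with \<open>inverse \<infinity> = 0\<close>
  and \<open>0 * \<infinity> = 0\<close>; so the quotient is \<open>0\<close> also when the ball has infinite capacity.\<close>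

definition choquet_maximal ::
  "((real ^ 'n) set \<Rightarrow> ennreal) \<Rightarrow> (real ^ 'n \<Rightarrow> real) \<Rightarrow> real ^ 'n \<Rightarrow> ennreal" where
  "choquet_maximal C f x =
     (SUP r \<in> {0<..}. if C (ball x r) = 0 then 0
        else choquet_integral C (ball x r) (\<lambda>y. ennreal \<bar>f y\<bar>) / C (ball x r))"

definition ennreal_powr :: "ennreal \<Rightarrow> real \<Rightarrow> ennreal" where  \<comment> \<open>only meant for positive exponents\<close>
  "ennreal_powr a p = (if a = \<infinity> then \<infinity> else ennreal (enn2real a powr p))"

end

theory Submission
  imports Defs
begin

text \<open>
  If some ball has capacity \<open>0\<close> or \<open>\<infinity>\<close>, doubling forces the same for all balls and the
  maximal function vanishes. Otherwise, if \<open>M f x > t\<close>, covering a ball by boundedly many dyadic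
  cubes of comparable size gives a cube near \<open>x\<close> whose \<open>C\<close>-average of \<open>\<bar>f\<bar>\<close> is at least a fixed
  multiple of \<open>t\<close> (a heavy cube). In each orthant with corner \<open>xQ\<close>, the maximal heavy cubes are
  disjoint, and (P) is applied to them (or, if the orthant has too little capacity, to a
  subfamily) with the orthant itself as \<open>Q'\<close>. If heavy cubes grow without bound, then
  \<open>t * C UNIV\<close> is already controlled by the integral, since \<open>C UNIV\<close> is at most a constant times the
  supremum of the capacities along any increasing chain of cubes.

  For the strong bound, \<open>M f \<le> M (f restricted to {\<bar>f\<bar> > t/2}) + t/2\<close> and the weak bound, followed by a splitting of
  the integral of the truncation into the layers \<open>2^(k-1) t < \<bar>f\<bar> \<le> 2^k t\<close>, give
  \<open>C {M f > t} \<le> 2 K (\<Sum>k. 2^k C {\<bar>f\<bar> > 2^(k-1) t})\<close>. After the substitution \<open>t = \<tau> powr (1/p)\<close> each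
  summand is a linear dilation of the level function of \<open>\<bar>f\<bar> powr p\<close>, and the dilation factors sum
  to a convergent geometric series because \<open>p > 1\<close>.
\<close>

subsection \<open>Outer capacities and Choquet integrals\<close>

lemma borel_measurable_antimono_ennreal:
  fixes g :: "real \<Rightarrow> ennreal"
  assumes "antimono g"
  shows "g \<in> borel_measurable borel"
proof (rule borel_measurableI_greater)
  fix y
  have "is_interval {x. y < g x}"
    unfolding is_interval_1 using antimonoD[OF assms] by (auto intro: less_le_trans)
  then have "{x. y < g x} \<in> sets borel"
    by (rule real_interval_borel_measurable)
  then show "{x \<in> space borel. y < g x} \<in> sets borel" by simp
qed

text \<open>By induction: the new member \<open>R\<close> is dropped while the rest still sums to at
  least \<open>M\<close>; otherwise the rest alone reaches half of \<open>M\<close>, or else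
  \<open>R\<close> alone does. Serves to thin out a family until (P) applies to it.\<close>

lemma finite_sum_half_subset:
  fixes c :: "'b \<Rightarrow> ennreal"
  assumes "finite G" "\<And>R. R \<in> G \<Longrightarrow> c R \<le> M" "M \<le> sum c G" "M < \<infinity>"
  shows "\<exists>G'\<subseteq>G. sum c G' \<le> M \<and> M \<le> 2 * sum c G'"
  using assms
proof (induction G rule: finite_induct)
  case empty
  then show ?case by auto
next
  case (insert R G)
  consider "M \<le> sum c G" | "sum c G < M" "M \<le> 2 * sum c G" | "2 * sum c G < M"
    using not_le by blast
  then show ?case
  proof cases
    case 1
    then obtain G' where "G' \<subseteq> G" "sum c G' \<le> M \<and> M \<le> 2 * sum c G'"
      using insert by auto
    then show ?thesis by blast
  next
    case 2
    then show ?thesis by (intro exI[of _ G]) auto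
  next
    case 3
    have M: "M \<le> c R + sum c G" using insert by simp
    have cR: "c R \<le> M" using insert by simp
    obtain m where m: "M = ennreal m" "m \<ge> 0"
      using insert.prems by (cases M) auto
    have "c R < \<infinity>" using cR insert.prems by (auto intro: le_less_trans)
    then obtain r where r: "c R = ennreal r" "r \<ge> 0" by (cases "c R") auto
    have "sum c G < \<infinity>"
    proof (rule ccontr)
      assume "\<not> sum c G < \<infinity>"
      then have "sum c G = \<infinity>" by (simp flip: less_top)
      with 3 show False by (simp add: ennreal_mult_top)
    qed
    then obtain s where s: "sum c G = ennreal s" "s \<ge> 0" by (cases "sum c G") auto
    have "2 * s < m" using 3 m s
      by (metis ennreal_less_iff ennreal_mult' ennreal_numeral mult_nonneg_nonneg zero_le_numeral)
    moreover have "m \<le> r + s" using M m r s by (simp flip: ennreal_plus)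
    ultimately have "m \<le> 2 * r" by linarith
    then have "M \<le> 2 * c R" using m r
      by (metis ennreal_leI ennreal_mult' ennreal_numeral zero_le_numeral)
    with cR show ?thesis by (intro exI[of _ "{R}"]) auto
  qed
qed

locale outer_cap =
  fixes C :: "(real ^ 'n) set \<Rightarrow> ennreal"
  assumes outer_capacity: "outer_capacity C"
begin

lemma empty [simp]: "C {} = 0"
  using outer_capacity unfolding outer_capacity_def by blast

lemma mono: "A \<subseteq> B \<Longrightarrow> C A \<le> C B"
  using outer_capacity unfolding outer_capacity_def by blast

lemma countable_subadditive: "C (\<Union>i. S i) \<le> (\<Sum>i. C (S (i::nat)))"
  using outer_capacity unfolding outer_capacity_def by blast

lemma subadditive_bound:
  assumes "countable F" "\<And>G. finite G \<Longrightarrow> G \<subseteq> F \<Longrightarrow> (\<Sum>R\<in>G. C (g R)) \<le> B"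
  shows "C (\<Union>R\<in>F. g R) \<le> B"
proof -
  define S where "S i = (if i \<in> to_nat_on F ` F then g (from_nat_into F i) else {})" for i
  have "(\<Union>R\<in>F. g R) \<subseteq> (\<Union>i. S i)"
  proof
    fix x assume "x \<in> (\<Union>R\<in>F. g R)"
    then obtain R where "R \<in> F" "x \<in> g R" by blast
    then have "x \<in> S (to_nat_on F R)" using assms(1) by (simp add: S_def)
    then show "x \<in> (\<Union>i. S i)" by blast
  qed
  then have "C (\<Union>R\<in>F. g R) \<le> (\<Sum>i. C (S i))"
    using mono countable_subadditive order_trans by blast
  also have "\<dots> = (SUP n. \<Sum>i<n. C (S i))"
    by (rule suminf_eq_SUP)
  also have "\<dots> \<le> B"
  proof (rule SUP_least)
    fix n :: nat
    define G where "G = {R \<in> F. to_nat_on F R < n}"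
    have inj: "inj_on (to_nat_on F) F" using assms(1) by (rule inj_on_to_nat_on)
    have injG: "inj_on (to_nat_on F) G" by (rule inj_on_subset[OF inj]) (auto simp: G_def)
    have "finite (to_nat_on F ` G)" by (rule finite_subset[of _ "{..<n}"]) (auto simp: G_def)
    then have fin: "finite G" using injG by (rule finite_imageD)
    have "(\<Sum>i<n. C (S i)) = (\<Sum>i\<in>to_nat_on F ` G. C (S i))"
      by (rule sum.mono_neutral_right) (auto simp: S_def G_def)
    also have "\<dots> = (\<Sum>R\<in>G. C (S (to_nat_on F R)))"
      by (rule sum.reindex_cong[OF injG]) simp_all
    also have "\<dots> = (\<Sum>R\<in>G. C (g R))"
      using assms(1) by (intro sum.cong) (auto simp: S_def G_def)
    also have "\<dots> \<le> B" using assms(2)[OF fin] by (auto simp: G_def)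
    finally show "(\<Sum>i<n. C (S i)) \<le> B" .
  qed
  finally show ?thesis .
qed

lemma finite_subadditive: "finite F \<Longrightarrow> C (\<Union>R\<in>F. g R) \<le> (\<Sum>R\<in>F. C (g R))"
  by (rule subadditive_bound) (auto intro: countable_finite sum_mono2)

section \<open>Choquet integrals: measurability of level functions, monotonicity, subadditivity in
  the domain\<close>

lemma level_measurable [measurable]: "(\<lambda>t. C {x \<in> A. f x > ennreal t}) \<in> borel_measurable borel"
proof (rule borel_measurable_antimono_ennreal, rule antimonoI)
  fix s t :: real
  assume "s \<le> t"
  then have "ennreal s \<le> ennreal t" by (rule ennreal_leI)
  then have "{x \<in> A. f x > ennreal t} \<subseteq> {x \<in> A. f x > ennreal s}"
    using le_less_trans by blast
  then show "C {x \<in> A. f x > ennreal t} \<le> C {x \<in> A. f x > ennreal s}" by (rule mono)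
qed

lemma choquet_mono:
  "A \<subseteq> B \<Longrightarrow> (\<And>x. x \<in> A \<Longrightarrow> f x \<le> g x) \<Longrightarrow> choquet_integral C A f \<le> choquet_integral C B g"
  unfolding choquet_integral_def
  by (intro nn_integral_mono mult_right_mono mono) (auto intro: less_le_trans)

lemma choquet_countable_Union:
  "choquet_integral C (\<Union>i. A i) f \<le> (\<Sum>i. choquet_integral C (A (i::nat)) f)"
proof -
  have "C {x \<in> (\<Union>i. A i). f x > ennreal t} \<le> (\<Sum>i. C {x \<in> A i. f x > ennreal t})" for t
    by (rule order_trans[OF mono countable_subadditive]) auto
  then have "choquet_integral C (\<Union>i. A i) f
      \<le> (\<integral>\<^sup>+ t. (\<Sum>i. C {x \<in> A i. f x > ennreal t} * indicator {0<..} t) \<partial>lborel)"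
    unfolding choquet_integral_def
    by (intro nn_integral_mono) (simp split: split_indicator)
  also have "\<dots> = (\<Sum>i. choquet_integral C (A i) f)"
    unfolding choquet_integral_def by (rule nn_integral_suminf) measurable
  finally show ?thesis .
qed

lemma choquet_finite_Union:
  assumes "finite E"
  shows "choquet_integral C (\<Union>e\<in>E. A e) f \<le> (\<Sum>e\<in>E. choquet_integral C (A e) f)"
proof -
  have "C {x \<in> (\<Union>e\<in>E. A e). f x > ennreal t} \<le> (\<Sum>e\<in>E. C {x \<in> A e. f x > ennreal t})" for t
    by (rule order_trans[OF mono finite_subadditive[OF assms]]) auto
  then have "choquet_integral C (\<Union>e\<in>E. A e) f
      \<le> (\<integral>\<^sup>+ t. (\<Sum>e\<in>E. C {x \<in> A e. f x > ennreal t} * indicator {0<..} t) \<partial>lborel)"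
    unfolding choquet_integral_def
    by (intro nn_integral_mono) (simp split: split_indicator)
  also have "\<dots> = (\<Sum>e\<in>E. choquet_integral C (A e) f)"
    unfolding choquet_integral_def by (rule nn_integral_sum) measurable
  finally show ?thesis .
qed

lemma choquet_le_bound:
  assumes "\<And>x. x \<in> A \<Longrightarrow> f x \<le> ennreal b" "b \<ge> 0"
  shows "choquet_integral C A f \<le> ennreal b * C A"
proof -
  have "choquet_integral C A f \<le> (\<integral>\<^sup>+ t. C A * indicator {0..b} t \<partial>lborel)"
    unfolding choquet_integral_def
  proof (intro nn_integral_mono)
    fix t :: real
    show "C {x \<in> A. ennreal t < f x} * indicator {0<..} t \<le> C A * indicator {0..b} t"
    proof (cases "0 < t \<and> t \<le> b")
      case True
      then show ?thesis by (auto intro: mono)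
    next
      case False
      then have "{x \<in> A. ennreal t < f x} = {}" if "0 < t"
      proof -
        have "ennreal b \<le> ennreal t" using False that by (intro ennreal_leI) auto
        then show ?thesis using assms(1) by (fastforce simp: not_less intro: order_trans)
      qed
      then show ?thesis by (cases "0 < t") (simp_all only: empty, simp_all)
    qed
  qed
  also have "\<dots> = ennreal b * C A"
    using assms(2) by (simp add: nn_integral_cmult mult.commute)
  finally show ?thesis .
qed

text \<open>Turns (P) with a constant integrand into a statement on capacities alone: those of the
  cubes sum to at most \<open>A0\<close> times that of their union.\<close>

lemma choquet_const_one: "choquet_integral C A (\<lambda>_. 1) = C A"
proof -
  have "choquet_integral C A (\<lambda>_. 1) = (\<integral>\<^sup>+ t. C A * indicator {0<..<1::real} t \<partial>lborel)"
    unfolding choquet_integral_def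
  proof (intro nn_integral_cong)
    fix t :: real
    have "ennreal t < 1 \<longleftrightarrow> t < 1" by (metis ennreal_1 ennreal_less_iff ennreal_less_one_iff)
    then show "C {x \<in> A. ennreal t < 1} * indicator {0<..} t = C A * indicator {0<..<1} t"
      by (auto split: split_indicator)
  qed
  also have "\<dots> = C A"
    by (simp add: nn_integral_cmult)
  finally show ?thesis .
qed

end

subsection \<open>Dyadic cubes\<close>

locale dyadic_grid =
  fixes xQ :: "real ^ 'n" and l :: real
  assumes l_pos: "l > 0"
begin

definition side :: "int \<Rightarrow> real" where "side k = 2 powi k * l"

text \<open>\<open>idx k x\<close> is the lattice point \<open>m\<close> of the generation-\<open>k\<close> cube containing \<open>x\<close>, so that the
  generation-\<open>k\<close> cubes are the classes of an equivalence relation and every one is \<open>dcube k x\<close>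
  for each of its points \<open>x\<close>.\<close>

definition idx :: "int \<Rightarrow> real ^ 'n \<Rightarrow> 'n \<Rightarrow> int" where
  "idx k x i = \<lfloor>(x $ i - xQ $ i) / side k\<rfloor>"

definition dcube :: "int \<Rightarrow> real ^ 'n \<Rightarrow> (real ^ 'n) set" where
  "dcube k x = {y. idx k y = idx k x}"

text \<open>\<open>J\<close> collects the coordinates in which the orthant points upwards; with
  subsets of a finite type as indices, the family is visibly finite.\<close>

definition orthant :: "'n set \<Rightarrow> (real ^ 'n) set" where
  "orthant J = {y. \<forall>i. xQ $ i \<le> y $ i \<longleftrightarrow> i \<in> J}"

lemma side_pos [simp]: "side k > 0"
  using l_pos by (simp add: side_def)

lemma side_nonzero [simp]: "side k \<noteq> 0"
  using side_pos[of k] by linarith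

lemma side_Suc: "side (k + 1) = 2 * side k"
  by (simp add: side_def power_int_add)

lemma side_mono: "j \<le> k \<Longrightarrow> side j \<le> side k"
  using l_pos by (simp add: side_def power_int_increasing)

lemma dcube_self [simp]: "x \<in> dcube k x"
  by (simp add: dcube_def)

lemma dcube_eq: "y \<in> dcube k x \<Longrightarrow> dcube k y = dcube k x"
  by (auto simp: dcube_def)

text \<open>Halving before taking the floor is integer division of the floor by 2, also for negative
  indices. The nesting of generations rests on this.\<close>

lemma idx_Suc: "idx (k + 1) x i = idx k x i div 2"
proof -
  have "(x $ i - xQ $ i) / side (k + 1) = ((x $ i - xQ $ i) / side k) / real_of_int 2"
    by (simp add: side_Suc)
  then show ?thesis
    unfolding idx_def by (simp only: floor_divide_real_eq_div)
qed

lemma dcube_Suc: "dcube k x \<subseteq> dcube (k + 1) x"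
  by (auto simp: dcube_def idx_Suc fun_eq_iff)

lemma dcube_mono: "j \<le> k \<Longrightarrow> dcube j x \<subseteq> dcube k x"
proof (induction k rule: int_ge_induct)
  case (step i)
  then show ?case using dcube_Suc by blast
qed simp

lemma dcube_eq_mono: "y \<in> dcube j x \<Longrightarrow> j \<le> k \<Longrightarrow> dcube k y = dcube k x"
  using dcube_mono dcube_eq by blast

lemma idx_eq_iff:
  "idx k y i = m \<longleftrightarrow> real_of_int m * side k \<le> y $ i - xQ $ i \<and> y $ i - xQ $ i < (real_of_int m + 1) * side k"
  by (simp add: idx_def floor_eq_iff pos_le_divide_eq pos_divide_less_eq)

lemma dcube_in_dyadic: "dcube k x \<in> dyadic_cubes xQ l"
proof -
  define m :: "real ^ 'n" where "m = (\<chi> i. real_of_int (idx k x i))"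
  have "dcube k x = (\<lambda>y. xQ + (2 powi k * l) *\<^sub>R (m + y)) ` {y. \<forall>i. 0 \<le> y $ i \<and> y $ i < 1}"
  proof (intro set_eqI iffI)
    fix y assume "y \<in> dcube k x"
    then have y: "real_of_int (idx k x i) * side k \<le> y $ i - xQ $ i"
      "y $ i - xQ $ i < (real_of_int (idx k x i) + 1) * side k" for i
      using idx_eq_iff[of k y i "idx k x i"] by (auto simp: dcube_def)
    define z where "z = (1 / side k) *\<^sub>R (y - xQ) - m"
    have "y = xQ + side k *\<^sub>R (m + z)"
      by (simp add: z_def less_imp_neq[OF side_pos, symmetric])
    moreover have "0 \<le> z $ i \<and> z $ i < 1" for i
      using y[of i] by (simp add: z_def m_def field_simps)
    ultimately show "y \<in> (\<lambda>y. xQ + (2 powi k * l) *\<^sub>R (m + y)) ` {y. \<forall>i. 0 \<le> y $ i \<and> y $ i < 1}"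
      unfolding side_def by blast
  next
    fix y assume "y \<in> (\<lambda>y. xQ + (2 powi k * l) *\<^sub>R (m + y)) ` {y. \<forall>i. 0 \<le> y $ i \<and> y $ i < 1}"
    then obtain z where z: "y = xQ + side k *\<^sub>R (m + z)" "\<And>i. 0 \<le> z $ i \<and> z $ i < 1"
      unfolding side_def by blast
    have "idx k y i = idx k x i" for i
      unfolding idx_eq_iff z(1) using z(2)[of i] by (simp add: m_def mult.commute mult_left_mono)
    then show "y \<in> dcube k x" by (auto simp: dcube_def)
  qed
  moreover have "\<forall>i. m $ i \<in> \<int>" by (simp add: m_def)
  ultimately show ?thesis unfolding dyadic_cubes_def dyadic_cubes0_def by blast
qed

lemma orthant_in_dyadic: "orthant J \<in> dyadic_cubes xQ l"
proof -
  let ?I = "\<lambda>i. if i \<in> J then {xQ $ i..} else {..<xQ $ i}"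
  have "(xQ $ i \<le> y $ i \<longleftrightarrow> i \<in> J) \<longleftrightarrow> y $ i \<in> ?I i" for y :: "real ^ 'n" and i by auto
  then have "orthant J = {y. \<forall>i. y $ i \<in> ?I i}" unfolding orthant_def by simp
  moreover have "\<forall>i. ?I i = {xQ $ i..} \<or> ?I i = {..<xQ $ i}" by simp
  ultimately show ?thesis
    unfolding dyadic_cubes_def orthants_def by (intro UnI2 CollectI exI[of _ ?I] conjI)
qed

text \<open>The sign of an index is the same in every generation, which is why no dyadic cube
  crosses a coordinate hyperplane through \<open>xQ\<close>.\<close>

lemma ge_corner_iff: "xQ $ i \<le> y $ i \<longleftrightarrow> 0 \<le> idx k y i"
proof -
  have "0 \<le> idx k y i \<longleftrightarrow> 0 \<le> (y $ i - xQ $ i) / side k" by (simp add: idx_def)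
  also have "\<dots> \<longleftrightarrow> 0 \<le> y $ i - xQ $ i" by (simp add: pos_le_divide_eq)
  finally show ?thesis by simp
qed

lemma dcube_subset_orthant: "x \<in> orthant J \<Longrightarrow> dcube k x \<subseteq> orthant J"
proof
  fix y assume x: "x \<in> orthant J" and "y \<in> dcube k x"
  then have "idx k y = idx k x" by (simp add: dcube_def)
  then have "xQ $ i \<le> y $ i \<longleftrightarrow> xQ $ i \<le> x $ i" for i
    unfolding ge_corner_iff[of _ _ k] by (rule arg_cong)
  with x show "y \<in> orthant J" unfolding orthant_def by blast
qed

lemma UN_orthant: "(\<Union>J. orthant J) = UNIV"
proof -
  have "y \<in> orthant {i. xQ $ i \<le> y $ i}" for y by (simp add: orthant_def)
  then show ?thesis by blast
qed

lemma dist_le_of_components: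
  fixes x y :: "real ^ 'n"
  assumes "\<And>i. \<bar>x $ i - y $ i\<bar> \<le> b"
  shows "dist x y \<le> real CARD('n) * b"
proof -
  have "dist x y \<le> (\<Sum>i\<in>UNIV. \<bar>x $ i - y $ i\<bar>)"
    unfolding dist_norm using norm_le_l1_cart[of "x - y"] by simp
  also have "\<dots> \<le> real CARD('n) * b"
    using sum_bounded_above[of UNIV "\<lambda>i. \<bar>x $ i - y $ i\<bar>" b] assms by simp
  finally show ?thesis .
qed

lemma dcube_dist:
  assumes "y \<in> dcube k x"
  shows "dist x y \<le> real CARD('n) * side k"
proof (rule dist_le_of_components)
  fix i
  have "idx k y i = idx k x i" using assms by (simp add: dcube_def)
  then show "\<bar>x $ i - y $ i\<bar> \<le> side k"
    using idx_eq_iff[of k x i "idx k x i"] idx_eq_iff[of k y i "idx k x i"]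
    by (simp add: algebra_simps abs_le_iff)
qed

text \<open>The centre of the cube serves as \<open>c\<close>. Under doubling, this inner ball
  bounds the capacity of the cube from below.\<close>

lemma dcube_contains_ball:
  obtains c where "c \<in> dcube k x" "ball c (side k / 2) \<subseteq> dcube k x"
proof
  define c :: "real ^ 'n" where "c = (\<chi> i. xQ $ i + (real_of_int (idx k x i) + 1/2) * side k)"
  show sub: "ball c (side k / 2) \<subseteq> dcube k x"
  proof
    fix y assume "y \<in> ball c (side k / 2)"
    then have "norm (c - y) < side k / 2" by (simp add: dist_norm)
    then have "\<bar>(c - y) $ i\<bar> < side k / 2" for i
      using component_le_norm_cart[of "c - y" i] by linarith
    then have *: "\<bar>c $ i - y $ i\<bar> < side k / 2" for i by simp
    have "idx k y i = idx k x i" for i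
      unfolding idx_eq_iff using *[of i] unfolding abs_less_iff c_def
      by (auto simp: algebra_simps)
    then show "y \<in> dcube k x" by (auto simp: dcube_def)
  qed
  then show "c \<in> dcube k x" using side_pos[of k] by (meson centre_in_ball half_gt_zero subsetD)
qed

lemma interior_dcube_nonempty: "interior (dcube k x) \<noteq> {}"
proof -
  obtain c where "ball c (side k / 2) \<subseteq> dcube k x" by (rule dcube_contains_ball)
  then have "ball c (side k / 2) \<subseteq> interior (dcube k x)" by (rule interior_maximal) simp
  then show ?thesis using side_pos[of k] by (metis centre_in_ball empty_iff half_gt_zero subsetD)
qed

section \<open>Choice of scale and the neighbours of a cube\<close>

lemma exists_scale:
  assumes "r > 0"
  obtains k where "r \<le> side k" "side k \<le> 2 * r"
proof
  define k where "k = \<lceil>log 2 (r / l)\<rceil>"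
  have rl: "r / l > 0" using assms l_pos by simp
  have pw: "2 powi k = 2 powr (real_of_int k)" by (simp add: powr_real_of_int')
  have "2 powr log 2 (r / l) \<le> 2 powr (real_of_int k)" by (simp add: k_def)
  then have "r / l \<le> 2 powi k" using rl pw by simp
  then show "r \<le> side k" using l_pos by (simp add: side_def field_simps)
  have "real_of_int k \<le> log 2 (r / l) + 1" unfolding k_def by linarith
  then have "2 powr (real_of_int k) \<le> 2 powr (log 2 (r / l) + 1)" by simp
  then have "2 powi k \<le> 2 * (r / l)" using rl pw by (simp add: powr_add mult.commute)
  then show "side k \<le> 2 * r" using l_pos by (simp add: side_def field_simps)
qed

definition neighbours :: "(real ^ 'n) set" where
  "neighbours = {e. \<forall>i. e $ i \<in> {-1, 0, 1}}"

lemma finite_neighbours: "finite neighbours"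
proof -
  have "finite (vec_nth ` neighbours)"
    by (rule finite_subset[of _ "UNIV \<rightarrow>\<^sub>E {-1, 0, 1}"])
      (auto simp: neighbours_def intro: finite_PiE)
  then show ?thesis
    by (rule finite_imageD) (auto simp: inj_on_def vec_eq_iff)
qed

lemma neighbours_nonempty: "neighbours \<noteq> {}"
proof -
  have "(0 :: real ^ 'n) \<in> neighbours" by (simp add: neighbours_def)
  then show ?thesis by blast
qed

lemma idx_shift: "e $ i = real_of_int m \<Longrightarrow> idx k (x + side k *\<^sub>R e) i = idx k x i + m"
proof -
  assume "e $ i = real_of_int m"
  then have "((x + side k *\<^sub>R e) $ i - xQ $ i) / side k = (x $ i - xQ $ i) / side k + real_of_int m"
    using side_pos[of k] by (simp add: field_simps)
  then show ?thesis by (simp add: idx_def)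
qed

text \<open>Within the ball each coordinate moves by less than one side length, so its floor index
  changes by at most one.\<close>

lemma ball_subset_neighbours:
  assumes "r \<le> side k"
  shows "ball x r \<subseteq> (\<Union>e\<in>neighbours. dcube k (x + side k *\<^sub>R e))"
proof
  fix y assume "y \<in> ball x r"
  then have n: "norm (y - x) < side k" using assms by (simp add: dist_norm norm_minus_commute)
  have *: "\<bar>y $ i - x $ i\<bar> < side k" for i
    using component_le_norm_cart[of "y - x" i] n by simp
  define m where "m i = idx k y i - idx k x i" for i
  define e :: "real ^ 'n" where "e = (\<chi> i. real_of_int (m i))"
  have m: "m i \<in> {-1, 0, 1}" for i
  proof -
    define a b where "a = (x $ i - xQ $ i) / side k" and "b = (y $ i - xQ $ i) / side k"
    have "b - a = (y $ i - x $ i) / side k" by (simp add: a_def b_def flip: diff_divide_distrib)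
    then have "\<bar>b - a\<bar> < 1" using *[of i] by (simp add: abs_divide)
    then have "\<bar>\<lfloor>b\<rfloor> - \<lfloor>a\<rfloor>\<bar> \<le> 1" by linarith
    then have "\<bar>m i\<bar> \<le> 1" by (simp add: m_def idx_def a_def b_def)
    then show ?thesis by auto
  qed
  have "e $ i \<in> {-1, 0, 1}" for i
  proof -
    have "e $ i = real_of_int (m i)" by (simp add: e_def)
    with m[of i] show ?thesis by auto
  qed
  then have "e \<in> neighbours" by (simp add: neighbours_def)
  moreover have "y \<in> dcube k (x + side k *\<^sub>R e)"
    unfolding dcube_def mem_Collect_eq
  proof
    fix i
    have "idx k (x + side k *\<^sub>R e) i = idx k x i + m i"
      by (rule idx_shift) (simp add: e_def)
    then show "idx k y i = idx k (x + side k *\<^sub>R e) i" by (simp add: m_def)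
  qed
  ultimately show "y \<in> (\<Union>e\<in>neighbours. dcube k (x + side k *\<^sub>R e))" by blast
qed

lemma dist_neighbour:
  assumes "e \<in> neighbours"
  shows "dist x (x + side k *\<^sub>R e) \<le> real CARD('n) * side k"
proof (rule dist_le_of_components)
  fix i
  have "e $ i \<in> {-1, 0, 1}" using assms unfolding neighbours_def by blast
  then have "\<bar>e $ i\<bar> \<le> 1" by auto
  then have "side k * \<bar>e $ i\<bar> \<le> side k * 1"
    by (intro mult_left_mono less_imp_le[OF side_pos])
  moreover have "\<bar>x $ i - (x + side k *\<^sub>R e) $ i\<bar> = side k * \<bar>e $ i\<bar>"
    by (simp add: abs_mult abs_of_pos[OF side_pos])
  ultimately show "\<bar>x $ i - (x + side k *\<^sub>R e) $ i\<bar> \<le> side k" by simp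
qed

end

subsection \<open>Doubling capacities and the packing condition\<close>

locale doubling_outer_cap = outer_cap C
  for C :: "(real ^ 'n) set \<Rightarrow> ennreal" +
  fixes D0 :: real
  assumes D0: "D0 \<ge> 1"
    and doubling: "\<And>x r. r > 0 \<Longrightarrow> C (ball x (2 * r)) \<le> ennreal D0 * C (ball x r)"
begin

lemma doubling_power: "r > 0 \<Longrightarrow> C (ball x (2 ^ q * r)) \<le> ennreal (D0 ^ q) * C (ball x r)"
proof (induction q)
  case (Suc q)
  have "C (ball x (2 ^ Suc q * r)) = C (ball x (2 * (2 ^ q * r)))" by (simp add: mult.assoc)
  also have "\<dots> \<le> ennreal D0 * C (ball x (2 ^ q * r))" using Suc.prems by (intro doubling) simp
  also have "\<dots> \<le> ennreal D0 * (ennreal (D0 ^ q) * C (ball x r))"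
    using Suc by (intro mult_left_mono) auto
  also have "\<dots> = ennreal (D0 ^ Suc q) * C (ball x r)"
    using D0 by (simp add: ennreal_mult mult.assoc)
  finally show ?case .
qed simp

lemma ball_scale:
  obtains K :: real where "K \<ge> 1" "\<And>x r. r > 0 \<Longrightarrow> C (ball x (a * r)) \<le> ennreal K * C (ball x r)"
proof -
  obtain q where q: "a < 2 ^ q" using real_arch_pow[of 2 a] by auto
  show ?thesis
  proof
    show "D0 ^ q \<ge> 1" using D0 by (rule one_le_power)
    fix x and r :: real assume r: "r > 0"
    have "C (ball x (a * r)) \<le> C (ball x (2 ^ q * r))"
      using q r by (intro mono subset_ball) simp
    with doubling_power[OF r] show "C (ball x (a * r)) \<le> ennreal (D0 ^ q) * C (ball x r)"
      by (rule order_trans[rotated])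
  qed
qed

text \<open>Every ball lies in a dilate of any other by a power of two, so doubling carries capacity
  0 or \<infinity> from one ball to all. Then every quotient vanishes, for infinite capacity because
  division by \<infinity> gives 0.\<close>

lemma degenerate_balls:
  assumes r0: "r0 > 0" and deg: "C (ball x0 r0) = 0 \<or> C (ball x0 r0) = \<infinity>"
  shows "choquet_maximal C f x = 0"
proof -
  have ball: "C (ball x r) = 0 \<or> C (ball x r) = \<infinity>" if r: "r > 0" for r
  proof -
    have sub: "\<exists>q. ball y s \<subseteq> ball y' (2 ^ q * s')" if "s' > 0" for y y' :: "real ^ 'n" and s s' :: real
    proof -
      obtain q where "(dist y y' + s) / s' < 2 ^ q" using real_arch_pow[of 2] by auto
      then have "dist y y' + s < 2 ^ q * s'" using that by (simp add: divide_less_eq)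
      moreover have "dist y' w \<le> dist y y' + dist y w" for w by (metis dist_commute dist_triangle)
      ultimately have "ball y s \<subseteq> ball y' (2 ^ q * s')" by (fastforce intro: le_less_trans)
      then show ?thesis by blast
    qed
    from deg show ?thesis
    proof
      assume 0: "C (ball x0 r0) = 0"
      obtain q where "ball x r \<subseteq> ball x0 (2 ^ q * r0)" using sub[OF r0] by blast
      then have "C (ball x r) \<le> ennreal (D0 ^ q) * C (ball x0 r0)"
        using doubling_power[OF r0] mono order_trans by blast
      then show ?thesis using 0 by simp
    next
      assume top: "C (ball x0 r0) = \<infinity>"
      obtain q where "ball x0 r0 \<subseteq> ball x (2 ^ q * r)" using sub[OF r] by blast
      then have "C (ball x0 r0) \<le> ennreal (D0 ^ q) * C (ball x r)"
        using doubling_power[OF r] mono order_trans by blast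
      then show ?thesis using top by (auto simp: top_unique ennreal_mult_eq_top_iff)
    qed
  qed
  have "choquet_maximal C f x \<le> 0"
    unfolding choquet_maximal_def
  proof (rule SUP_least)
    fix r :: real assume "r \<in> {0<..}"
    then show "(if C (ball x r) = 0 then 0
        else choquet_integral C (ball x r) (\<lambda>y. ennreal \<bar>f y\<bar>) / C (ball x r)) \<le> 0"
      using ball[of r] by auto
  qed
  then show ?thesis by simp
qed

end

text \<open>Here (P) is stated for finite families, where the unordered sum is an ordinary one;
  infinite families are reached through \<open>subadditive_bound\<close>. The last two assumptions
  single out the nondegenerate case.\<close>

locale packing_capacity = doubling_outer_cap C D0 + dyadic_grid xQ l
  for C :: "(real ^ 'n) set \<Rightarrow> ennreal" and D0 :: real and xQ :: "real ^ 'n" and l :: real +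
  fixes A0 :: real
  assumes A0: "A0 \<ge> 1"
    and packing: "\<And>Q' F f. Q' \<in> dyadic_cubes xQ l \<Longrightarrow> finite F \<Longrightarrow> F \<subseteq> dyadic_cubes xQ l \<Longrightarrow>
      non_overlapping F \<Longrightarrow> (\<And>R. R \<in> F \<Longrightarrow> R \<subseteq> Q') \<Longrightarrow> sum C F \<le> ennreal A0 * C Q' \<Longrightarrow>
      (\<Sum>R\<in>F. choquet_integral C R f) \<le> ennreal A0 * choquet_integral C (\<Union>F) f"
    and ball_nonzero: "\<And>x r. r > 0 \<Longrightarrow> C (ball x r) \<noteq> 0"
    and ball_finite: "\<And>x r. r > 0 \<Longrightarrow> C (ball x r) < \<infinity>"
begin

text \<open>A fixed dilate of the ball inscribed in the cube contains the ball around
  \<open>x\<close>; doubling then gives a constant independent of \<open>k\<close> and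
  \<open>x\<close>.\<close>

lemma ball_dcube:
  obtains K :: real where "K \<ge> 1" "\<And>k x. C (ball x (a * side k)) \<le> ennreal K * C (dcube k x)"
proof -
  obtain K where K: "K \<ge> 1"
      "\<And>x r. r > 0 \<Longrightarrow> C (ball x ((2 * (a + real CARD('n))) * r)) \<le> ennreal K * C (ball x r)"
    using ball_scale[of "2 * (a + real CARD('n))"] by blast
  show ?thesis
  proof
    fix k and x :: "real ^ 'n"
    obtain c where c: "c \<in> dcube k x" "ball c (side k / 2) \<subseteq> dcube k x"
      by (rule dcube_contains_ball)
    \<comment> \<open>The centre \<open>c\<close> is at most \<open>CARD('n)\<close> side lengths
      away from \<open>x\<close>; the factor 2 compensates for the inner radius
      \<open>side k / 2\<close>.\<close>
    have "ball x (a * side k) \<subseteq> ball c (2 * (a + real CARD('n)) * (side k / 2))"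
    proof
      fix y assume "y \<in> ball x (a * side k)"
      moreover have "dist c y \<le> dist x c + dist x y" by (metis dist_commute dist_triangle)
      moreover have "dist x c \<le> real CARD('n) * side k" using c(1) by (rule dcube_dist)
      ultimately have "dist c y < (a + real CARD('n)) * side k" by (simp add: distrib_right)
      then show "y \<in> ball c (2 * (a + real CARD('n)) * (side k / 2))" by (simp add: algebra_simps)
    qed
    then have "C (ball x (a * side k)) \<le> C (ball c (2 * (a + real CARD('n)) * (side k / 2)))"
      by (rule mono)
    also have "\<dots> \<le> ennreal K * C (ball c (side k / 2))" by (rule K(2)) simp
    also have "\<dots> \<le> ennreal K * C (dcube k x)" by (intro mult_left_mono mono c) simp
    finally show "C (ball x (a * side k)) \<le> ennreal K * C (dcube k x)" .
  qed (rule K(1))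
qed

section \<open>Comparison of the whole space with large balls and cubes\<close>

lemma bounded_dcube: "bounded (dcube k x)"
  unfolding bounded_def using dcube_dist by blast

lemma dcube_nonoverlapping: "pairwise disjnt F \<Longrightarrow> non_overlapping F"
  unfolding non_overlapping_def pairwise_def disjnt_def using interior_subset by blast

text \<open>Capacities need not be continuous from below, so this is not automatic. The point is the case
  in which balls have bounded capacity: some orthant would then have infinite capacity, so (P)
  would apply in it without restriction, also to arbitrarily many disjoint cubes
  going away from \<open>xQ\<close> with side comparable to their distance; by doubling all of these have
  capacity bounded from below.\<close>

lemma capacity_UNIV_bound_balls:
  obtains K :: real where "K \<ge> 1" "C UNIV \<le> ennreal K * (SUP r\<in>{0<..}. C (ball xQ r))"
proof -
  define S where "S = (SUP r\<in>{0<..}. C (ball xQ r))"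
  have S_upper: "C (ball xQ r) \<le> S" if "r > 0" for r
    unfolding S_def using that by (intro SUP_upper) simp
  have ball_l: "C (ball xQ l) \<noteq> 0" "C (ball xQ l) < \<infinity>"
    using ball_nonzero ball_finite l_pos by auto
  consider "S = \<infinity>" | "S < \<infinity>" "C UNIV < \<infinity>" | "S < \<infinity>" "C UNIV = \<infinity>"
    by (metis infinity_ennreal_def less_top)
  then show ?thesis
  proof cases
    case 1
    then have "C UNIV \<le> ennreal 1 * S" by simp
    then show ?thesis using that[of 1] unfolding S_def by simp
  next
    case 2
    obtain s where s: "S = ennreal s" "s \<ge> 0" using 2 by (cases S) auto
    obtain u where u: "C UNIV = ennreal u" "u \<ge> 0" using 2 by (cases "C UNIV") auto
    have "s > 0"
      using S_upper[OF l_pos] ball_l s by (cases "s = 0") auto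
    \<comment> \<open>Both capacities are finite and \<open>s\<close> is positive, so their ratio
      serves as the constant, raised to 1 if necessary.\<close>
    then have "u \<le> max 1 (u / s) * s" by (simp add: max_def field_simps)
    then have "C UNIV \<le> ennreal (max 1 (u / s)) * S"
      using s u by (simp add: ennreal_leI flip: ennreal_mult)
    then show ?thesis unfolding S_def by (rule that[rotated]) simp
  next
    case 3
    \<comment> \<open>This case is refuted. Finitely many orthants cover the space, so one of them
      has infinite capacity.\<close>
    obtain J where J: "C (orthant J) = \<infinity>"
    proof (rule ccontr)
      assume "\<not> thesis"
      then have "C (orthant J) < \<infinity>" for J using that by (metis infinity_ennreal_def less_top)
      then have "(\<Sum>J\<in>UNIV. C (orthant J)) < \<infinity>" by simp
      moreover have "C UNIV \<le> (\<Sum>J\<in>UNIV. C (orthant J))"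
        using finite_subadditive[of "UNIV :: 'n set set" orthant] by (simp add: UN_orthant)
      ultimately have "C UNIV < \<infinity>" by (rule le_less_trans[rotated])
      then show False using 3 by simp
    qed
    \<comment> \<open>The entries make \<open>z k\<close> the centre of a cube with indices 1 or -2:
      relative to \<open>xQ\<close>, each coordinate of \<open>T k\<close> runs through
      \<open>[s, 2s)\<close> or \<open>[-2s, -s)\<close> with \<open>s = side (int k)\<close>. These
      ranges are disjoint for different \<open>k\<close>, and the distance to \<open>xQ\<close> is
      comparable to the side.\<close>
    define \<sigma> :: "real ^ 'n" where "\<sigma> = (\<chi> i. if i \<in> J then 3/2 else -3/2)"
    define z where "z k = xQ + side (int k) *\<^sub>R \<sigma>" for k
    define T where "T k = dcube (int k) (z k)" for k
    have idx_z: "idx (int k) (z k) i = (if i \<in> J then 1 else -2)" for k i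
      by (simp add: idx_def z_def \<sigma>_def)
    have z_orthant: "z k \<in> orthant J" for k
      by (simp add: orthant_def ge_corner_iff[of _ _ "int k"] idx_z)
    have disj: "T j \<inter> T k = {}" if "j < k" for j k
    proof (rule ccontr)
      assume "T j \<inter> T k \<noteq> {}"
      then obtain y where y: "y \<in> T j" "y \<in> T k" by blast
      \<comment> \<open>Any single coordinate already separates the two cubes.\<close>
      obtain i :: 'n where True by simp
      have "idx (int j) y i = (if i \<in> J then 1 else -2)" "idx (int k) y i = (if i \<in> J then 1 else -2)"
        using y idx_z by (simp_all add: T_def dcube_def)
      moreover have "2 * side (int j) \<le> side (int k)"
        using side_mono[of "int j + 1" "int k"] that by (simp add: side_Suc)
      ultimately show False by (simp add: idx_eq_iff split: if_splits)
    qed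
    then have disj': "T j \<inter> T k = {}" if "j \<noteq> k" for j k
      using that by (metis Int_commute linorder_neqE_nat)
    have T_nonempty: "T k \<noteq> {}" for k unfolding T_def using dcube_self by blast
    have inj: "inj T" by (rule injI) (metis disj' T_nonempty Int_absorb)
    have \<sigma>_dist: "dist xQ (z k) \<le> real CARD('n) * (2 * side (int k))" for k
      by (rule dist_le_of_components) (simp add: z_def \<sigma>_def abs_mult less_imp_le[OF side_pos])
    obtain K where K: "K \<ge> 1"
      "\<And>k x. C (ball x ((2 * real CARD('n) + 1) * side k)) \<le> ennreal K * C (dcube k x)"
      using ball_dcube[of "2 * real CARD('n) + 1"] by blast
    have lower: "C (ball xQ l) \<le> ennreal K * C (T k)" for k
    proof -
      have "side 0 \<le> side (int k)" by (rule side_mono) simp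
      then have "l \<le> side (int k)" by (simp add: side_def)
      have "ball xQ l \<subseteq> ball (z k) ((2 * real CARD('n) + 1) * side (int k))"
      proof
        fix y assume "y \<in> ball xQ l"
        moreover have "dist (z k) y \<le> dist xQ (z k) + dist xQ y" by (metis dist_commute dist_triangle)
        ultimately show "y \<in> ball (z k) ((2 * real CARD('n) + 1) * side (int k))"
          using \<sigma>_dist[of k] \<open>l \<le> side (int k)\<close> by (simp add: algebra_simps)
      qed
      then show ?thesis using K(2)[of "z k" "int k"] mono unfolding T_def by (meson order_trans)
    qed
    \<comment> \<open>The right-hand side is finite and free of \<open>N\<close>, while each of the
      \<open>N\<close> disjoint cubes has at least a fixed positive capacity; a large
      \<open>N\<close> gives the contradiction.\<close>
    have upper: "of_nat N * C (ball xQ l) \<le> ennreal K * (ennreal A0 * S)" for N :: nat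
    proof -
      have "bounded (\<Union>k<N. T k)"
        unfolding T_def by (intro bounded_UN ballI bounded_dcube) simp
      then obtain r where r: "r > 0" "(\<Union>k<N. T k) \<subseteq> ball xQ r"
        using bounded_subset_ballD by metis
      have "(\<Sum>k<N. C (T k)) = (\<Sum>R\<in>T ` {..<N}. choquet_integral C R (\<lambda>_. 1))"
        using inj by (subst sum.reindex) (auto simp: choquet_const_one intro: inj_on_subset)
      also have "\<dots> \<le> ennreal A0 * choquet_integral C (\<Union>(T ` {..<N})) (\<lambda>_. 1)"
      proof (rule packing[OF orthant_in_dyadic[of J]])
        show "T ` {..<N} \<subseteq> dyadic_cubes xQ l" unfolding T_def using dcube_in_dyadic by blast
        have "pairwise disjnt (T ` {..<N})"
          unfolding pairwise_image by (intro pairwiseI) (metis disj' disjnt_def)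
        then show "non_overlapping (T ` {..<N})" by (rule dcube_nonoverlapping)
        show "R \<subseteq> orthant J" if "R \<in> T ` {..<N}" for R
          using that dcube_subset_orthant[OF z_orthant] unfolding T_def by blast
        \<comment> \<open>The orthant has infinite capacity, so the smallness condition of (P) holds
          trivially.\<close>
        show "sum C (T ` {..<N}) \<le> ennreal A0 * C (orthant J)"
          using J A0 by (simp add: ennreal_mult_top)
      qed simp
      also have "\<dots> \<le> ennreal A0 * S"
        unfolding choquet_const_one using mono[OF r(2)] S_upper[OF r(1)]
        by (intro mult_left_mono) auto
      finally have sum: "(\<Sum>k<N. C (T k)) \<le> ennreal A0 * S" .
      have "of_nat N * C (ball xQ l) = (\<Sum>k<N. C (ball xQ l))" by simp
      also have "\<dots> \<le> (\<Sum>k<N. ennreal K * C (T k))" by (intro sum_mono lower)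
      also have "\<dots> \<le> ennreal K * (ennreal A0 * S)"
        unfolding sum_distrib_left[symmetric] by (intro mult_left_mono sum) simp
      finally show ?thesis .
    qed
    have "ennreal K * (ennreal A0 * S) < \<infinity>" using 3 by (simp add: ennreal_mult_less_top)
    then obtain u where u: "ennreal K * (ennreal A0 * S) = ennreal u" "u \<ge> 0"
      by (cases "ennreal K * (ennreal A0 * S)") auto
    obtain b where b: "C (ball xQ l) = ennreal b" "b > 0"
      using ball_l by (cases "C (ball xQ l)") (auto simp: order_less_le)
    obtain N :: nat where N: "u < real N * b" using b(2) ex_less_of_nat_mult by blast
    have "ennreal (real N * b) \<le> ennreal u"
      using upper[of N] b u by (simp add: ennreal_mult ennreal_of_nat_eq_real_of_nat)
    then show ?thesis using N u by simp
  qed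
qed

text \<open>The cubes around \<open>z\<close> fill at most one orthant. Still, by doubling, each is
  comparable to the ball around \<open>z\<close> with its side as radius, and these balls eventually
  contain any ball around \<open>xQ\<close>. The constant does not depend on
  \<open>z\<close>.\<close>

lemma capacity_UNIV_bound_dcubes:
  obtains K :: real where "K \<ge> 1" "\<And>z. C UNIV \<le> ennreal K * (SUP j. C (dcube j z))"
proof -
  obtain K1 where K1: "K1 \<ge> 1" "C UNIV \<le> ennreal K1 * (SUP r\<in>{0<..}. C (ball xQ r))"
    by (rule capacity_UNIV_bound_balls)
  obtain K2 where K2: "K2 \<ge> 1" "\<And>k x. C (ball x (1 * side k)) \<le> ennreal K2 * C (dcube k x)"
    using ball_dcube[of 1] by blast
  show ?thesis
  proof
    show "K1 * K2 \<ge> 1" using K1(1) K2(1) by (metis mult_mono mult_1 zero_le_one order_trans)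
    fix z
    have "C (ball xQ r) \<le> ennreal K2 * (SUP j. C (dcube j z))" if "r > 0" for r
    proof -
      have "r + dist xQ z > 0" using that by (simp add: add_pos_nonneg)
      then obtain j where j: "r + dist xQ z \<le> side j" by (rule exists_scale)
      have "ball xQ r \<subseteq> ball z (1 * side j)"
      proof
        fix y assume "y \<in> ball xQ r"
        moreover have "dist z y \<le> dist xQ z + dist xQ y" by (metis dist_commute dist_triangle)
        ultimately show "y \<in> ball z (1 * side j)" using j by simp
      qed
      then have "C (ball xQ r) \<le> ennreal K2 * C (dcube j z)" using mono K2(2) order_trans by blast
      also have "\<dots> \<le> ennreal K2 * (SUP j. C (dcube j z))"
        by (intro mult_left_mono SUP_upper) auto
      finally show ?thesis .
    qed
    then have "(SUP r\<in>{0<..}. C (ball xQ r)) \<le> ennreal K2 * (SUP j. C (dcube j z))"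
      by (intro SUP_least) simp
    then have "C UNIV \<le> ennreal K1 * (ennreal K2 * (SUP j. C (dcube j z)))"
      by (intro order_trans[OF K1(2)] mult_left_mono) auto
    then show "C UNIV \<le> ennreal (K1 * K2) * (SUP j. C (dcube j z))"
      using K1(1) K2(1) by (simp add: ennreal_mult mult.assoc)
  qed
qed

text \<open>If the family is too large for (P), a subfamily of total capacity between
  half of \<open>C (orthant J)\<close> and \<open>C (orthant J)\<close> is not.\<close>

lemma packing_sum:
  assumes fin: "finite G" and G: "\<And>R. R \<in> G \<Longrightarrow> \<exists>k x. x \<in> orthant J \<and> R = dcube k x"
    and disj: "pairwise disjnt G"
    and bad: "\<And>R. R \<in> G \<Longrightarrow> ennreal \<mu> * C R \<le> choquet_integral C R f"
  shows "ennreal \<mu> * min (sum C G) (C (orthant J)) \<le> ennreal (2 * A0) * choquet_integral C UNIV f"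
proof -
  have sub: "R \<subseteq> orthant J" if "R \<in> G" for R using G[OF that] dcube_subset_orthant by blast
  have admissible: "ennreal \<mu> * sum C H \<le> ennreal A0 * choquet_integral C UNIV f"
    if H: "H \<subseteq> G" "sum C H \<le> ennreal A0 * C (orthant J)" for H
  proof -
    have "ennreal \<mu> * sum C H \<le> (\<Sum>R\<in>H. choquet_integral C R f)"
      unfolding sum_distrib_left using H bad by (intro sum_mono) blast
    also have "\<dots> \<le> ennreal A0 * choquet_integral C (\<Union>H) f"
    proof (rule packing[OF orthant_in_dyadic[of J]])
      show "finite H" using H fin finite_subset by blast
      show "H \<subseteq> dyadic_cubes xQ l" using H G dcube_in_dyadic by blast
      show "non_overlapping H" using H disj pairwise_subset dcube_nonoverlapping by blast
    qed (use H sub in auto)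
    also have "\<dots> \<le> ennreal A0 * choquet_integral C UNIV f"
      by (intro mult_left_mono choquet_mono) auto
    finally show ?thesis .
  qed
  have A0': "c \<le> ennreal A0 * c" for c
    using mult_right_mono[of 1 "ennreal A0" c] A0 by simp
  have two: "ennreal (2 * A0) * I = 2 * (ennreal A0 * I)" for I
    using A0 by (simp add: ennreal_mult mult.assoc)
  show ?thesis
  proof (cases "sum C G \<le> C (orthant J)")
    case True
    have "ennreal \<mu> * sum C G \<le> ennreal A0 * choquet_integral C UNIV f"
      using admissible[OF subset_refl order_trans[OF True A0']] .
    also have "\<dots> \<le> ennreal (2 * A0) * choquet_integral C UNIV f"
      using A0 by (intro mult_right_mono ennreal_leI) auto
    finally show ?thesis using True by (simp add: min_def)
  next
    case False
    \<comment> \<open>The strict inequality makes the capacity of the orthant finite, as the choice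
      of the subfamily requires.\<close>
    then have le: "C (orthant J) \<le> sum C G" and fin_O: "C (orthant J) < \<infinity>"
      by (auto simp: not_le intro: less_le_trans)
    have "C R \<le> C (orthant J)" if "R \<in> G" for R using sub[OF that] by (rule mono)
    from finite_sum_half_subset[OF fin this le fin_O]
    obtain H where H: "H \<subseteq> G" "sum C H \<le> C (orthant J)" "C (orthant J) \<le> 2 * sum C H" by blast
    have "ennreal \<mu> * C (orthant J) \<le> ennreal \<mu> * (2 * sum C H)" by (intro mult_left_mono H) simp
    also have "\<dots> = 2 * (ennreal \<mu> * sum C H)" by (simp add: mult.left_commute)
    also have "\<dots> \<le> 2 * (ennreal A0 * choquet_integral C UNIV f)"
      using admissible[OF H(1) order_trans[OF H(2) A0']] by (intro mult_left_mono) simp_all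
    finally show ?thesis using le by (simp add: two min.absorb2)
  qed
qed

end

subsection \<open>The weak type estimate\<close>

context packing_capacity
begin

text \<open>Heaviness is attached to a generation and a point rather than to a set, so that the
  ancestors of a cube arise by raising \<open>k\<close> with the point fixed.\<close>

definition heavy :: "(real ^ 'n \<Rightarrow> ennreal) \<Rightarrow> real \<Rightarrow> int \<Rightarrow> real ^ 'n \<Rightarrow> bool" where
  "heavy f \<mu> k z \<longleftrightarrow> ennreal \<mu> * C (dcube k z) \<le> choquet_integral C (dcube k z) f"

definition maximal_heavy :: "(real ^ 'n \<Rightarrow> ennreal) \<Rightarrow> real \<Rightarrow> int \<Rightarrow> real ^ 'n \<Rightarrow> bool" where
  "maximal_heavy f \<mu> k z \<longleftrightarrow> heavy f \<mu> k z \<and> (\<forall>j>k. \<not> heavy f \<mu> j z)"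

lemma heavy_cong: "dcube k y = dcube k z \<Longrightarrow> heavy f \<mu> k y \<longleftrightarrow> heavy f \<mu> k z"
  by (simp add: heavy_def)

text \<open>Two points of one cube share all of its ancestors as well.\<close>

lemma maximal_heavy_transfer:
  assumes "y \<in> dcube k z" "maximal_heavy f \<mu> k z"
  shows "maximal_heavy f \<mu> k y"
  using assms(2) heavy_cong dcube_eq_mono[OF assms(1)] unfolding maximal_heavy_def
  by (metis less_imp_le order_refl)

lemma maximal_heavy_unique:
  assumes "maximal_heavy f \<mu> j z" "maximal_heavy f \<mu> k z"
  shows "j = k"
  using assms unfolding maximal_heavy_def by (metis linorder_neqE)

text \<open>Capacities grow along the chain of cubes around \<open>z\<close>, so each of them is
  dominated by that of a heavy cube further up.\<close>

lemma heavy_unbounded: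
  assumes "\<And>b. \<exists>j\<ge>b. heavy f \<mu> j z"
  shows "ennreal \<mu> * (SUP j. C (dcube j z)) \<le> choquet_integral C UNIV f"
  unfolding SUP_mult_left_ennreal
proof (rule SUP_least)
  fix b
  obtain j where j: "j \<ge> b" "heavy f \<mu> j z" using assms by blast
  have "ennreal \<mu> * C (dcube b z) \<le> ennreal \<mu> * C (dcube j z)"
    by (intro mult_left_mono mono dcube_mono j) simp
  also have "\<dots> \<le> choquet_integral C (dcube j z) f" using j by (simp add: heavy_def)
  also have "\<dots> \<le> choquet_integral C UNIV f" by (rule choquet_mono) auto
  finally show "ennreal \<mu> * C (dcube b z) \<le> choquet_integral C UNIV f" .
qed

lemma heavy_maximal_above:
  assumes "\<And>j. j \<ge> b \<Longrightarrow> \<not> heavy f \<mu> j z" "heavy f \<mu> k z"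
  obtains j where "j \<ge> k" "maximal_heavy f \<mu> j z"
proof -
  define J where "J = {j. k \<le> j \<and> heavy f \<mu> j z}"
  have mem: "j \<in> J \<longleftrightarrow> k \<le> j \<and> heavy f \<mu> j z" for j by (simp add: J_def)
  have "finite J"
  proof (rule finite_subset)
    show "J \<subseteq> {k..b}"
    proof
      fix j assume "j \<in> J"
      then have "k \<le> j" "\<not> b \<le> j" using assms(1) unfolding J_def by blast+
      then show "j \<in> {k..b}" by simp
    qed
  qed simp
  moreover have "J \<noteq> {}" using assms(2) by (auto simp: J_def)
  ultimately have m: "Max J \<in> J" "\<And>j. j \<in> J \<Longrightarrow> j \<le> Max J" by auto
  have "\<not> heavy f \<mu> j z" if "Max J < j" for j
  proof
    assume "heavy f \<mu> j z"
    then have "j \<in> J" using m(1) that by (simp add: mem)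
    then show False using m(2)[of j] that by simp
  qed
  then have "maximal_heavy f \<mu> (Max J) z"
    unfolding maximal_heavy_def using m(1) mem by blast
  then show ?thesis using that m(1) mem by blast
qed

text \<open>The covering argument inside one orthant. If heavy cubes around one point grow without
  bound, or if finitely many maximal ones exhaust the capacity of the orthant, then
  \<open>C UNIV\<close> is already controlled; otherwise the capacities of dilated maximal cubes are
  summed.\<close>

lemma heavy_cover:
  obtains K :: real where "K > 0"
    "\<And>f \<mu> J. \<mu> > 0 \<Longrightarrow>
      ennreal \<mu> * C (\<Union>{ball z (a * side k) | k z. z \<in> orthant J \<and> heavy f \<mu> k z})
        \<le> ennreal K * choquet_integral C UNIV f"
proof -
  obtain K1 where K1: "K1 \<ge> 1" "\<And>z. C UNIV \<le> ennreal K1 * (SUP j. C (dcube j z))"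
    using capacity_UNIV_bound_dcubes by blast
  obtain K2 where K2: "K2 \<ge> 1"
      "\<And>k x. C (ball x ((\<bar>a\<bar> + real CARD('n)) * side k)) \<le> ennreal K2 * C (dcube k x)"
    using ball_dcube[of "\<bar>a\<bar> + real CARD('n)"] by blast
  \<comment> \<open>The three summands are the constants of the three cases below.\<close>
  define K where "K = K1 + K2 * (2 * A0) + K1 * (2 * A0)"
  have le_K: "K1 \<le> K" "K2 * (2 * A0) \<le> K" "K1 * (2 * A0) \<le> K"
    using K1(1) K2(1) A0 by (simp_all add: K_def)
  have K_pos: "K > 0" using le_K(1) K1(1) by linarith
  \<comment> \<open>An orthant contains all dyadic cubes around any of its points, so it carries a
    fixed fraction of the total capacity.\<close>
  have UNIV_le: "C UNIV \<le> ennreal K1 * C (orthant J)" for J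
  proof -
    define z :: "real ^ 'n" where "z = (\<chi> i. if i \<in> J then xQ $ i else xQ $ i - 1)"
    have "z \<in> orthant J" by (simp add: z_def orthant_def)
    then have "(SUP j. C (dcube j z)) \<le> C (orthant J)"
      by (intro SUP_least mono dcube_subset_orthant)
    then show ?thesis using K1(2)[of z] by (meson mult_left_mono order_trans zero_le)
  qed
  have "ennreal \<mu> * C (\<Union>{ball z (a * side k) | k z. z \<in> orthant J \<and> heavy f \<mu> k z})
        \<le> ennreal K * choquet_integral C UNIV f" if \<mu>: "\<mu> > 0" for f \<mu> J
  proof -
    define I where "I = choquet_integral C UNIV f"
    define B where "B = \<Union>{ball z (a * side k) | k z. z \<in> orthant J \<and> heavy f \<mu> k z}"
    have bound_UNIV: ?thesis if "ennreal \<mu> * C UNIV \<le> ennreal c * I" "c \<le> K" for c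
    proof -
      have "ennreal \<mu> * C B \<le> ennreal \<mu> * C UNIV" by (intro mult_left_mono mono) auto
      also have "\<dots> \<le> ennreal c * I" by (rule that)
      also have "\<dots> \<le> ennreal K * I" using that by (intro mult_right_mono ennreal_leI) auto
      finally show ?thesis unfolding I_def B_def .
    qed
    show ?thesis
    proof (cases "\<exists>z\<in>orthant J. \<forall>b. \<exists>j\<ge>b. heavy f \<mu> j z")
      case True
      then obtain z where z: "\<And>b. \<exists>j\<ge>b. heavy f \<mu> j z" by blast
      have "ennreal \<mu> * C UNIV \<le> ennreal \<mu> * (ennreal K1 * (SUP j. C (dcube j z)))"
        by (intro mult_left_mono K1) simp
      also have "\<dots> = ennreal K1 * (ennreal \<mu> * (SUP j. C (dcube j z)))"
        by (rule mult.left_commute)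
      also have "\<dots> \<le> ennreal K1 * I"
        unfolding I_def by (intro mult_left_mono heavy_unbounded z) simp
      finally show ?thesis using le_K(1) by (rule bound_UNIV)
    next
      case False
      define P where "P = {(k, z). z \<in> orthant J \<and> maximal_heavy f \<mu> k z}"
      define F where "F = (\<lambda>(k, z). dcube k z) ` P"
      \<comment> \<open>At a common point both cubes would be maximal heavy, which forces equal
        generations and hence equal cubes.\<close>
      have disj: "pairwise disjnt F"
      proof (rule pairwiseI)
        fix R R' assume R: "R \<in> F" "R' \<in> F" and neq: "R \<noteq> R'"
        obtain j z where jz: "maximal_heavy f \<mu> j z" "R = dcube j z"
          using R by (auto simp: F_def P_def)
        obtain k w where kw: "maximal_heavy f \<mu> k w" "R' = dcube k w"
          using R by (auto simp: F_def P_def)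
        show "disjnt R R'"
        proof (rule ccontr)
          assume "\<not> disjnt R R'"
          then obtain y where y: "y \<in> dcube j z" "y \<in> dcube k w"
            using jz kw by (auto simp: disjnt_def)
          then have "j = k" using jz kw maximal_heavy_transfer maximal_heavy_unique by blast
          then show False using dcube_eq[OF y(1)] dcube_eq[OF y(2)] jz kw neq by simp
        qed
      qed
      have countable: "countable F"
        by (rule countable_disjoint_nonempty_interior_subsets[OF disj])
          (use interior_dcube_nonempty in \<open>auto simp: F_def\<close>)
      have "\<exists>p. p \<in> P \<and> R = dcube (fst p) (snd p)" if "R \<in> F" for R
        using that unfolding F_def by force
      then obtain rep where rep: "\<And>R. R \<in> F \<Longrightarrow> rep R \<in> P \<and> R = dcube (fst (rep R)) (snd (rep R))"
        by metis
      \<comment> \<open>A smaller heavy cube with its dilated ball is absorbed by the maximal cube: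
        \<open>\<bar>a\<bar>\<close> accounts for the dilation, \<open>CARD('n)\<close> for moving
        the centre to the representative point.\<close>
      define star where
        "star R = ball (snd (rep R)) ((\<bar>a\<bar> + real CARD('n)) * side (fst (rep R)))" for R
      have cover: "B \<subseteq> (\<Union>R\<in>F. star R)"
      proof
        fix y assume "y \<in> B"
        then obtain k z where y: "y \<in> ball z (a * side k)" and z: "z \<in> orthant J" "heavy f \<mu> k z"
          unfolding B_def by blast
        obtain b where "\<And>j. j \<ge> b \<Longrightarrow> \<not> heavy f \<mu> j z" using False z(1) by blast
        then obtain j where j: "j \<ge> k" "maximal_heavy f \<mu> j z" using z(2) by (rule heavy_maximal_above)
        define R where "R = dcube j z"
        have R: "R \<in> F" using z j by (auto simp: F_def P_def R_def)
        \<comment> \<open>\<open>rep\<close> may describe the same cube by other data; uniqueness of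
          the maximal generation at \<open>z\<close> forces \<open>i = j\<close>.\<close>
        define i w where "i = fst (rep R)" and "w = snd (rep R)"
        have iw: "maximal_heavy f \<mu> i w" "dcube j z = dcube i w"
          using rep[OF R] by (auto simp: P_def i_def w_def R_def case_prod_beta)
        have "z \<in> dcube i w" using iw(2) dcube_self by blast
        then have "maximal_heavy f \<mu> i z" using iw(1) by (rule maximal_heavy_transfer)
        then have "i = j" using j(2) by (rule maximal_heavy_unique)
        have "dist w y \<le> dist w z + dist z y" by (rule dist_triangle)
        moreover have "dist w z \<le> real CARD('n) * side j"
          using dcube_dist[OF \<open>z \<in> dcube i w\<close>] \<open>i = j\<close> by simp
        moreover have "dist z y < \<bar>a\<bar> * side j"
        proof -
          have "dist z y < a * side k" using y by simp
          also have "\<dots> \<le> \<bar>a\<bar> * side j"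
            using side_mono[OF j(1)] by (intro mult_mono) (auto intro: less_imp_le)
          finally show ?thesis .
        qed
        ultimately have "y \<in> star R"
          using \<open>i = j\<close> by (simp add: star_def i_def w_def distrib_right)
        with R show "y \<in> (\<Union>R\<in>F. star R)" by blast
      qed
      have sums: "ennreal \<mu> * min (sum C G) (C (orthant J)) \<le> ennreal (2 * A0) * I"
        if G: "finite G" "G \<subseteq> F" for G
        unfolding I_def
      proof (rule packing_sum[OF G(1)])
        show "pairwise disjnt G" using disj G(2) by (rule pairwise_subset)
        show "\<exists>k x. x \<in> orthant J \<and> R = dcube k x" if "R \<in> G" for R
          using subsetD[OF G(2) that] by (auto simp: F_def P_def)
        show "ennreal \<mu> * C R \<le> choquet_integral C R f" if "R \<in> G" for R
          using subsetD[OF G(2) that] by (auto simp: F_def P_def maximal_heavy_def heavy_def)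
      qed
      show ?thesis
      proof (cases "\<exists>G\<subseteq>F. finite G \<and> C (orthant J) \<le> sum C G")
        case True
        then obtain G where "G \<subseteq> F" "finite G" "C (orthant J) \<le> sum C G" by blast
        with sums[of G] have O: "ennreal \<mu> * C (orthant J) \<le> ennreal (2 * A0) * I"
          by (simp add: min.absorb2)
        have "ennreal \<mu> * C UNIV \<le> ennreal \<mu> * (ennreal K1 * C (orthant J))"
          by (intro mult_left_mono UNIV_le) simp
        also have "\<dots> = ennreal K1 * (ennreal \<mu> * C (orthant J))" by (rule mult.left_commute)
        also have "\<dots> \<le> ennreal K1 * (ennreal (2 * A0) * I)" by (intro mult_left_mono O) simp
        also have "\<dots> = ennreal (K1 * (2 * A0)) * I"
          using K1(1) A0 by (simp add: ennreal_mult mult.assoc)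
        finally show ?thesis using le_K(3) by (rule bound_UNIV)
      next
        case False
        have mu_cancel: "ennreal \<mu> * (ennreal (1 / \<mu>) * x) = x"
          "ennreal (1 / \<mu>) * (ennreal \<mu> * x) = x" for x
          using \<mu> by (simp_all flip: mult.assoc ennreal_mult)
        have "C B \<le> C (\<Union>R\<in>F. star R)" using cover by (rule mono)
        also have "\<dots> \<le> ennreal K2 * (ennreal (1 / \<mu>) * (ennreal (2 * A0) * I))"
        proof (rule subadditive_bound[OF countable])
          fix G assume G: "finite G" "G \<subseteq> F"
          have "(\<Sum>R\<in>G. C (star R)) \<le> (\<Sum>R\<in>G. ennreal K2 * C R)"
          proof (rule sum_mono)
            fix R assume "R \<in> G"
            then have "R = dcube (fst (rep R)) (snd (rep R))" using G(2) rep by blast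
            with K2(2)[of "snd (rep R)" "fst (rep R)"] show "C (star R) \<le> ennreal K2 * C R"
              unfolding star_def by simp
          qed
          also have "\<dots> = ennreal K2 * sum C G" by (simp add: sum_distrib_left)
          also have "\<dots> \<le> ennreal K2 * (ennreal (1 / \<mu>) * (ennreal (2 * A0) * I))"
          proof (rule mult_left_mono)
            \<comment> \<open>No finite subfamily reaches the capacity of the orthant here, so the
              minimum in \<open>sums\<close> is the sum itself.\<close>
            have "sum C G < C (orthant J)" using False G by (simp add: not_le)
            then have "ennreal \<mu> * sum C G \<le> ennreal (2 * A0) * I"
              using sums[OF G] by (simp add: min.absorb1)
            then have "ennreal (1 / \<mu>) * (ennreal \<mu> * sum C G) \<le> ennreal (1 / \<mu>) * (ennreal (2 * A0) * I)"
              by (rule mult_left_mono) simp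
            then show "sum C G \<le> ennreal (1 / \<mu>) * (ennreal (2 * A0) * I)"
              unfolding mu_cancel .
          qed simp
          finally show "(\<Sum>R\<in>G. C (star R)) \<le> ennreal K2 * (ennreal (1 / \<mu>) * (ennreal (2 * A0) * I))" .
        qed
        finally have "ennreal \<mu> * C B \<le> ennreal \<mu> * (ennreal K2 * (ennreal (1 / \<mu>) * (ennreal (2 * A0) * I)))"
          by (rule mult_left_mono) simp
        also have "\<dots> = ennreal K2 * (ennreal (2 * A0) * I)"
          unfolding mult.left_commute[of "ennreal \<mu>" "ennreal K2"] mu_cancel ..
        also have "\<dots> = ennreal (K2 * (2 * A0)) * I"
          using K2(1) A0 by (simp add: ennreal_mult mult.assoc)
        also have "\<dots> \<le> ennreal K * I" using le_K(2) by (intro mult_right_mono ennreal_leI) auto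
        finally show ?thesis unfolding I_def B_def .
      qed
    qed
  qed
  with K_pos show ?thesis by (rule that)
qed

text \<open>Pigeonhole: the neighbouring cubes covering a ball of large average have capacity at
  most \<open>K1\<close> times that of the ball. Were none of them heavy at level
  \<open>t / K\<close>, subadditivity would bound the average by \<open>t\<close>.\<close>

lemma choquet_maximal_heavy:
  obtains K :: real where "K > 0"
    "\<And>f t x. t > 0 \<Longrightarrow> choquet_maximal C f x > ennreal t \<Longrightarrow>
       \<exists>k z. x \<in> ball z (real (CARD('n) + 1) * side k) \<and> heavy (\<lambda>y. ennreal \<bar>f y\<bar>) (t / K) k z"
proof -
  \<comment> \<open>Neighbouring cubes stay within \<open>2 * CARD('n)\<close> sides of
    \<open>x\<close>, and a side is at most \<open>2 * r\<close>; the extra 2 makes the inclusion in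
    the open ball strict.\<close>
  obtain K1 where K1: "K1 \<ge> 1"
      "\<And>x r. r > 0 \<Longrightarrow> C (ball x ((4 * real CARD('n) + 2) * r)) \<le> ennreal K1 * C (ball x r)"
    using ball_scale[of "4 * real CARD('n) + 2"] by blast
  define N where "N = card neighbours"
  have N: "N > 0" using finite_neighbours neighbours_nonempty by (simp add: N_def card_gt_0_iff)
  define K where "K = K1 * real N"
  have K: "K > 0" using K1(1) N by (simp add: K_def)
  have "\<exists>k z. x \<in> ball z (real (CARD('n) + 1) * side k) \<and> heavy (\<lambda>y. ennreal \<bar>f y\<bar>) (t / K) k z"
    if t: "t > 0" and M: "choquet_maximal C f x > ennreal t" for f t x
  proof -
    define g where "g = (\<lambda>y. ennreal \<bar>f y\<bar>)"
    obtain r where r: "r > 0" and "ennreal t < (if C (ball x r) = 0 then 0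
        else choquet_integral C (ball x r) g / C (ball x r))"
      using M unfolding choquet_maximal_def less_SUP_iff g_def by auto
    then have "ennreal t < choquet_integral C (ball x r) g / C (ball x r)"
      using ball_nonzero by simp
    then have big: "ennreal t * C (ball x r) < choquet_integral C (ball x r) g"
      using divide_le_posI_ennreal[of "C (ball x r)" "choquet_integral C (ball x r) g" "ennreal t"]
        ball_nonzero[OF r] by (metis mult.commute not_le zero_less_iff_neq_zero)
    obtain k where k: "r \<le> side k" "side k \<le> 2 * r" using r by (rule exists_scale)
    define D where "D e = dcube k (x + side k *\<^sub>R e)" for e
    have D_cap: "C (D e) \<le> ennreal K1 * C (ball x r)" if e: "e \<in> neighbours" for e
    proof -
      have "D e \<subseteq> ball x ((4 * real CARD('n) + 2) * r)"
      proof
        fix y assume "y \<in> D e"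
        then have "dist (x + side k *\<^sub>R e) y \<le> real CARD('n) * side k"
          unfolding D_def by (rule dcube_dist)
        then have "dist x y \<le> 2 * real CARD('n) * side k"
          using dist_neighbour[OF e, of x k] dist_triangle[of x y "x + side k *\<^sub>R e"] by linarith
        also have "\<dots> \<le> 2 * real CARD('n) * (2 * r)" by (intro mult_left_mono k) simp
        finally show "y \<in> ball x ((4 * real CARD('n) + 2) * r)" using r by (simp add: distrib_right)
      qed
      then show ?thesis using K1(2)[OF r] mono order_trans by blast
    qed
    have "\<exists>e\<in>neighbours. ennreal (t / K) * C (D e) \<le> choquet_integral C (D e) g"
    proof (rule ccontr)
      assume "\<not> ?thesis"
      then have less: "choquet_integral C (D e) g \<le> ennreal (t / K) * C (D e)"
        if "e \<in> neighbours" for e using that by (auto simp: not_le)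
      have "choquet_integral C (ball x r) g \<le> choquet_integral C (\<Union>e\<in>neighbours. D e) g"
        unfolding D_def by (intro choquet_mono ball_subset_neighbours k) auto
      also have "\<dots> \<le> (\<Sum>e\<in>neighbours. choquet_integral C (D e) g)"
        by (rule choquet_finite_Union[OF finite_neighbours])
      also have "\<dots> \<le> (\<Sum>e\<in>neighbours. ennreal (t / K) * (ennreal K1 * C (ball x r)))"
        by (intro sum_mono order_trans[OF less] mult_left_mono D_cap) auto
      also have "\<dots> = ennreal (real N * (t / K * K1)) * C (ball x r)"
      proof -
        have "t / K \<ge> 0" "t / K * K1 \<ge> 0" using t K K1(1) by simp_all
        then have "ennreal (real N * (t / K * K1)) = of_nat N * (ennreal (t / K) * ennreal K1)"
          using K1(1) by (simp only: ennreal_mult ennreal_of_nat_eq_real_of_nat of_nat_0_le_iff)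
        then show ?thesis by (simp only: sum_constant N_def mult.assoc)
      qed
      also have "real N * (t / K * K1) = t" using K1(1) N by (simp add: K_def)
      finally show False using big by simp
    qed
    then obtain e where e: "e \<in> neighbours" "heavy g (t / K) k (x + side k *\<^sub>R e)"
      by (auto simp: heavy_def D_def)
    have "x \<in> ball (x + side k *\<^sub>R e) (real (CARD('n) + 1) * side k)"
      using dist_neighbour[OF e(1), of x k] side_pos[of k]
      by (simp add: distrib_right dist_commute del: side_pos)
    with e(2) show ?thesis unfolding g_def by blast
  qed
  with K show ?thesis by (rule that)
qed

text \<open>Each point of the superlevel set lies near a heavy cube in some orthant; the covering
  bounds are added over the finitely many orthants.\<close>

lemma weak_type:
  obtains K :: real where "K > 0"
    "\<And>f t. t > 0 \<Longrightarrow> C {x. choquet_maximal C f x > ennreal t}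
       \<le> ennreal (K / t) * choquet_integral C UNIV (\<lambda>x. ennreal \<bar>f x\<bar>)"
proof -
  define a where "a = real (CARD('n) + 1)"
  obtain K1 where K1: "K1 > 0"
    "\<And>f t x. t > 0 \<Longrightarrow> choquet_maximal C f x > ennreal t \<Longrightarrow>
       \<exists>k z. x \<in> ball z (a * side k) \<and> heavy (\<lambda>y. ennreal \<bar>f y\<bar>) (t / K1) k z"
    using choquet_maximal_heavy unfolding a_def by blast
  obtain K2 where K2: "K2 > 0"
    "\<And>f \<mu> J. \<mu> > 0 \<Longrightarrow>
      ennreal \<mu> * C (\<Union>{ball z (a * side k) | k z. z \<in> orthant J \<and> heavy f \<mu> k z})
        \<le> ennreal K2 * choquet_integral C UNIV f"
    using heavy_cover[of a] by blast
  define N where "N = real CARD('n set)"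
  define K where "K = K1 * (N * K2)"
  have "C {x. choquet_maximal C f x > ennreal t}
       \<le> ennreal (K / t) * choquet_integral C UNIV (\<lambda>x. ennreal \<bar>f x\<bar>)" if t: "t > 0" for f t
  proof -
    define g where "g = (\<lambda>y. ennreal \<bar>f y\<bar>)"
    define \<mu> where "\<mu> = t / K1"
    have \<mu>: "\<mu> > 0" using t K1(1) by (simp add: \<mu>_def)
    define B where "B J = \<Union>{ball z (a * side k) | k z. z \<in> orthant J \<and> heavy g \<mu> k z}" for J
    have sub: "{x. choquet_maximal C f x > ennreal t} \<subseteq> (\<Union>J\<in>UNIV. B J)"
    proof
      fix x assume "x \<in> {x. choquet_maximal C f x > ennreal t}"
      then obtain k z where "x \<in> ball z (a * side k)" "heavy g \<mu> k z"
        using K1(2)[OF t] unfolding g_def \<mu>_def by blast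
      moreover obtain J where "z \<in> orthant J" using UN_orthant by blast
      ultimately show "x \<in> (\<Union>J\<in>UNIV. B J)" unfolding B_def by blast
    qed
    have "ennreal \<mu> * C {x. choquet_maximal C f x > ennreal t} \<le> ennreal \<mu> * (\<Sum>J\<in>UNIV. C (B J))"
      by (intro mult_left_mono order_trans[OF mono[OF sub] finite_subadditive]) auto
    also have "\<dots> = (\<Sum>J\<in>UNIV. ennreal \<mu> * C (B J))" by (rule sum_distrib_left)
    also have "\<dots> \<le> (\<Sum>J\<in>(UNIV :: 'n set set). ennreal K2 * choquet_integral C UNIV g)"
      unfolding B_def by (intro sum_mono K2(2) \<mu>)
    also have "\<dots> = ennreal (N * K2) * choquet_integral C UNIV g"
      using K2(1) by (simp only: sum_constant N_def ennreal_of_nat_eq_real_of_nat)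
        (simp add: ennreal_mult mult.assoc)
    finally have "ennreal (1 / \<mu>) * (ennreal \<mu> * C {x. choquet_maximal C f x > ennreal t})
        \<le> ennreal (1 / \<mu>) * (ennreal (N * K2) * choquet_integral C UNIV g)"
      by (rule mult_left_mono) simp
    moreover have "ennreal (1 / \<mu>) * (ennreal \<mu> * c) = c" for c
      using \<mu> by (simp flip: mult.assoc ennreal_mult)
    moreover have "ennreal (1 / \<mu>) * (ennreal (N * K2) * c) = ennreal (K / t) * c" for c
    proof -
      have "1 / \<mu> * (N * K2) = K / t" by (simp add: \<mu>_def K_def)
      then show ?thesis using \<mu> K2(1) by (simp add: N_def flip: mult.assoc ennreal_mult)
    qed
    ultimately show ?thesis unfolding g_def by simp
  qed
  moreover have "K > 0" using K1(1) K2(1) by (simp add: K_def N_def)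
  ultimately show ?thesis using that by blast
qed

end

subsection \<open>From the weak to the strong type estimate\<close>

context outer_cap
begin

lemma choquet_Un:
  "choquet_integral C (A \<union> B) f \<le> choquet_integral C A f + choquet_integral C B f"
  using choquet_finite_Union[of UNIV "\<lambda>b. if b then A else B" f] by (simp add: UNIV_bool Un_commute add.commute)

lemma choquet_support:
  assumes "\<And>x. x \<notin> A \<Longrightarrow> f x = 0"
  shows "choquet_integral C UNIV f = choquet_integral C A f"
proof -
  have "{x \<in> UNIV. ennreal t < f x} = {x \<in> A. ennreal t < f x}" for t
    using assms by fastforce
  then show ?thesis unfolding choquet_integral_def by simp
qed

section \<open>Truncation and dyadic layers\<close>

definition truncate :: "real \<Rightarrow> (real ^ 'n \<Rightarrow> real) \<Rightarrow> real ^ 'n \<Rightarrow> real" where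
  "truncate s f y = (if s < \<bar>f y\<bar> then f y else 0)"

text \<open>The Choquet integral need not be subadditive in the integrand, so each ball is split
  instead: where \<open>\<bar>f\<bar>\<close> is at most \<open>s\<close>, the integral is at most
  \<open>s\<close> times the capacity.\<close>

lemma choquet_maximal_truncate:
  assumes "s \<ge> 0"
  shows "choquet_maximal C f x \<le> choquet_maximal C (truncate s f) x + ennreal s"
  unfolding choquet_maximal_def[of C f]
proof (rule SUP_least)
  fix r :: real assume r: "r \<in> {0<..}"
  define B where "B = ball x r"
  let ?g = "\<lambda>y. ennreal \<bar>f y\<bar>" and ?h = "\<lambda>y. ennreal \<bar>truncate s f y\<bar>"
  show "(if C (ball x r) = 0 then 0 else choquet_integral C (ball x r) ?g / C (ball x r))
      \<le> choquet_maximal C (truncate s f) x + ennreal s"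
  proof (cases "C B = 0")
    case False
    have "choquet_integral C B ?g
        \<le> choquet_integral C (B \<inter> {y. s < \<bar>f y\<bar>}) ?g + choquet_integral C (B \<inter> {y. \<not> s < \<bar>f y\<bar>}) ?g"
      by (rule order_trans[OF choquet_mono choquet_Un]) auto
    also have "\<dots> \<le> choquet_integral C B ?h + ennreal s * C B"
    proof (rule add_mono)
      show "choquet_integral C (B \<inter> {y. s < \<bar>f y\<bar>}) ?g \<le> choquet_integral C B ?h"
        by (rule choquet_mono) (auto simp: truncate_def)
      have "choquet_integral C (B \<inter> {y. \<not> s < \<bar>f y\<bar>}) ?g \<le> ennreal s * C (B \<inter> {y. \<not> s < \<bar>f y\<bar>})"
        using assms by (intro choquet_le_bound ennreal_leI) auto
      also have "\<dots> \<le> ennreal s * C B" by (intro mult_left_mono mono) auto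
      finally show "choquet_integral C (B \<inter> {y. \<not> s < \<bar>f y\<bar>}) ?g \<le> ennreal s * C B" .
    qed
    finally have "choquet_integral C B ?g / C B \<le> (choquet_integral C B ?h + ennreal s * C B) / C B"
      by (rule divide_right_mono_ennreal)
    also have "\<dots> \<le> choquet_integral C B ?h / C B + ennreal s"
    \<comment> \<open>For infinite capacity both quotients are 0; cancelling \<open>C B\<close> is
      legitimate only in the finite case.\<close>
    proof (cases "C B = \<infinity>")
      case True
      then show ?thesis by simp
    next
      case finite: False
      then have "ennreal s * C B / C B = ennreal s"
        using False by (intro ennreal_mult_divide_eq) (auto simp: mult.commute)
      then show ?thesis by (simp add: add_divide_distrib_ennreal)
    qed
    also have "\<dots> \<le> choquet_maximal C (truncate s f) x + ennreal s"
    proof (rule add_right_mono)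
      show "choquet_integral C B ?h / C B \<le> choquet_maximal C (truncate s f) x"
        unfolding choquet_maximal_def using r False by (intro SUP_upper2[of r]) (auto simp: B_def)
    qed
    finally show ?thesis using False by (simp add: B_def)
  qed (simp add: B_def)
qed

text \<open>Again the domain is split: the layers cover the support of the truncation, and on the
  \<open>k\<close>-th one its absolute value is at most \<open>2 ^ k * t\<close>.\<close>

lemma choquet_truncate_layers:
  assumes t: "t > 0"
  shows "choquet_integral C UNIV (\<lambda>y. ennreal \<bar>truncate (t / 2) f y\<bar>)
    \<le> (\<Sum>k. ennreal (2 ^ k * t) * C {x. 2 ^ k / 2 * t < \<bar>f x\<bar>})"
proof -
  define A where "A k = {x. 2 ^ k / 2 * t < \<bar>f x\<bar> \<and> \<bar>f x\<bar> \<le> 2 ^ k * t}" for k :: nat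
  let ?h = "\<lambda>y. ennreal \<bar>truncate (t / 2) f y\<bar>"
  have cover: "\<exists>k. x \<in> A k" if x: "t / 2 < \<bar>f x\<bar>" for x
  proof -
    obtain k0 :: nat where "\<bar>f x\<bar> / t < 2 ^ k0" using real_arch_pow[of 2 "\<bar>f x\<bar> / t"] by auto
    then have k0: "\<bar>f x\<bar> \<le> 2 ^ k0 * t" using t by (simp add: divide_less_eq)
    \<comment> \<open>Minimality of \<open>k\<close> gives the lower bound of the layer; for
      \<open>k = 0\<close> that bound is the truncation threshold.\<close>
    define k where "k = (LEAST k. \<bar>f x\<bar> \<le> 2 ^ k * t)"
    have k: "\<bar>f x\<bar> \<le> 2 ^ k * t" unfolding k_def using k0 by (rule LeastI)
    have "2 ^ k / 2 * t < \<bar>f x\<bar>"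
    proof (cases k)
      case 0
      then show ?thesis using x by simp
    next
      case (Suc j)
      then have "\<not> \<bar>f x\<bar> \<le> 2 ^ j * t"
        using not_less_Least[of j "\<lambda>k. \<bar>f x\<bar> \<le> 2 ^ k * t"] by (simp add: k_def)
      then show ?thesis using Suc by simp
    qed
    with k show ?thesis by (auto simp: A_def)
  qed
  have "choquet_integral C UNIV ?h = choquet_integral C (\<Union>k. A k) ?h"
    by (rule choquet_support) (use cover in \<open>auto simp: truncate_def\<close>)
  also have "\<dots> \<le> (\<Sum>k. choquet_integral C (A k) ?h)" by (rule choquet_countable_Union)
  also have "\<dots> \<le> (\<Sum>k. ennreal (2 ^ k * t) * C {x. 2 ^ k / 2 * t < \<bar>f x\<bar>})"
  proof (rule suminf_le)
    fix k
    have "choquet_integral C (A k) ?h \<le> ennreal (2 ^ k * t) * C (A k)"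
      using t by (intro choquet_le_bound ennreal_leI) (auto simp: A_def truncate_def)
    also have "\<dots> \<le> ennreal (2 ^ k * t) * C {x. 2 ^ k / 2 * t < \<bar>f x\<bar>}"
      by (intro mult_left_mono mono) (auto simp: A_def)
    finally show "choquet_integral C (A k) ?h \<le> ennreal (2 ^ k * t) * C {x. 2 ^ k / 2 * t < \<bar>f x\<bar>}" .
  qed auto
  finally show ?thesis .
qed

text \<open>The weak bound is applied to the truncation at level \<open>t / 2\<close>, whence the
  factor 2; the discarded part adds at most \<open>t / 2\<close> to the maximal function.\<close>

lemma weak_type_layers:
  assumes K: "K > 0" and t: "t > 0"
    and weak: "\<And>f t. t > 0 \<Longrightarrow> C {x. choquet_maximal C f x > ennreal t}
       \<le> ennreal (K / t) * choquet_integral C UNIV (\<lambda>x. ennreal \<bar>f x\<bar>)"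
  shows "C {x. choquet_maximal C f x > ennreal t}
    \<le> (\<Sum>k. ennreal (2 * K * 2 ^ k) * C {x. 2 ^ k / 2 * t < \<bar>f x\<bar>})"
proof -
  have "{x. choquet_maximal C f x > ennreal t} \<subseteq> {x. choquet_maximal C (truncate (t / 2) f) x > ennreal (t / 2)}"
  proof (intro subsetI CollectI, rule ccontr)
    fix x assume x: "x \<in> {x. choquet_maximal C f x > ennreal t}"
      and "\<not> ennreal (t / 2) < choquet_maximal C (truncate (t / 2) f) x"
    then have "choquet_maximal C (truncate (t / 2) f) x + ennreal (t / 2) \<le> ennreal (t / 2) + ennreal (t / 2)"
      by (intro add_right_mono) (simp add: not_less)
    also have "\<dots> = ennreal t" using t by (simp flip: ennreal_plus)
    finally have "choquet_maximal C f x \<le> ennreal t"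
      using choquet_maximal_truncate[of "t / 2" f x] t by simp
    with x show False by simp
  qed
  then have "C {x. choquet_maximal C f x > ennreal t}
      \<le> ennreal (K / (t / 2)) * choquet_integral C UNIV (\<lambda>y. ennreal \<bar>truncate (t / 2) f y\<bar>)"
    using t by (intro order_trans[OF mono weak]) auto
  also have "\<dots> \<le> ennreal (K / (t / 2)) * (\<Sum>k. ennreal (2 ^ k * t) * C {x. 2 ^ k / 2 * t < \<bar>f x\<bar>})"
    by (intro mult_left_mono choquet_truncate_layers t) simp
  also have "\<dots> = (\<Sum>k. ennreal (K / (t / 2)) * (ennreal (2 ^ k * t) * C {x. 2 ^ k / 2 * t < \<bar>f x\<bar>}))"
    by simp
  also have "\<dots> = (\<Sum>k. ennreal (2 * K * 2 ^ k) * C {x. 2 ^ k / 2 * t < \<bar>f x\<bar>})"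
  proof (rule suminf_cong)
    fix k :: nat
    have "ennreal (K / (t / 2)) * ennreal (2 ^ k * t) = ennreal (K / (t / 2) * (2 ^ k * t))"
      using K t by (intro ennreal_mult[symmetric]) auto
    also have "K / (t / 2) * (2 ^ k * t) = 2 * K * 2 ^ k" using t by simp
    finally show "ennreal (K / (t / 2)) * (ennreal (2 ^ k * t) * C {x. 2 ^ k / 2 * t < \<bar>f x\<bar>})
        = ennreal (2 * K * 2 ^ k) * C {x. 2 ^ k / 2 * t < \<bar>f x\<bar>}"
      by (simp add: mult.assoc[symmetric])
  qed
  finally show ?thesis .
qed

text \<open>Derived from the weak bound for an outer capacity, so it also covers degenerate
  balls.\<close>

lemma strong_type_of_weak_type:
  assumes K: "K > 0" and p: "p > 1"
    and weak: "\<And>f t. t > 0 \<Longrightarrow> C {x. choquet_maximal C f x > ennreal t}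
       \<le> ennreal (K / t) * choquet_integral C UNIV (\<lambda>x. ennreal \<bar>f x\<bar>)"
  shows "choquet_integral C UNIV (\<lambda>x. ennreal_powr (choquet_maximal C f x) p)
    \<le> ennreal (2 * K * 2 powr p / (1 - 2 powr (1 - p))) *
        choquet_integral C UNIV (\<lambda>x. ennreal (\<bar>f x\<bar> powr p))"
proof -
  define H where "H \<tau> = C {x \<in> UNIV. ennreal (\<bar>f x\<bar> powr p) > ennreal \<tau>}" for \<tau>
  \<comment> \<open>With \<open>t = \<tau> powr (1 / p)\<close>, the layer threshold
    \<open>2 ^ k / 2 * t\<close> raised to the power \<open>p\<close> is
    \<open>c k * \<tau>\<close>.\<close>
  define c where "c k = (2 ^ k / 2 :: real) powr p" for k :: nat
  define I where "I = choquet_integral C UNIV (\<lambda>x. ennreal (\<bar>f x\<bar> powr p))"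
  have I: "I = (\<integral>\<^sup>+\<tau>. H \<tau> * indicator {0<..} \<tau> \<partial>lborel)"
    by (simp add: I_def H_def choquet_integral_def)
  have H_meas [measurable]: "H \<in> borel_measurable borel"
    unfolding H_def by (rule level_measurable)
  have c_pos: "c k > 0" for k by (simp add: c_def)
  have powr_less: "a < b powr p" if "a powr (1 / p) < b" "a > 0" for a b :: real
  proof -
    have "(a powr (1 / p)) powr p < b powr p" using that p by (intro powr_less_mono2) auto
    then show ?thesis using p that by (simp add: powr_powr)
  qed
  have less_powr: "a powr (1 / p) < b" if "a < b powr p" "a > 0" "b \<ge> 0" for a b :: real
  proof -
    have "a powr (1 / p) < (b powr p) powr (1 / p)" using that p by (intro powr_less_mono2) auto
    then show ?thesis using p that by (simp add: powr_powr)
  qed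
  have level: "C {x \<in> UNIV. ennreal_powr (choquet_maximal C f x) p > ennreal \<tau>}
      \<le> (\<Sum>k. ennreal (2 * K * 2 ^ k) * H (c k * \<tau>))" if \<tau>: "\<tau> > 0" for \<tau>
  proof -
    define t where "t = \<tau> powr (1 / p)"
    have t: "t > 0" using \<tau> by (simp add: t_def)
    have "{x \<in> UNIV. ennreal_powr (choquet_maximal C f x) p > ennreal \<tau>}
        \<subseteq> {x. choquet_maximal C f x > ennreal t}"
    proof (intro subsetI CollectI)
      fix x assume x: "x \<in> {x \<in> UNIV. ennreal_powr (choquet_maximal C f x) p > ennreal \<tau>}"
      show "choquet_maximal C f x > ennreal t"
      proof (cases "choquet_maximal C f x")
        case (real m)
        then have "ennreal \<tau> < ennreal (m powr p)" using x by (simp add: ennreal_powr_def)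
        then have "\<tau> < m powr p" using \<tau> by (simp add: ennreal_less_iff)
        then have "t < m" unfolding t_def using \<tau> real by (intro less_powr) auto
        then show ?thesis using real t by (simp add: ennreal_less_iff)
      qed simp
    qed
    then have "C {x \<in> UNIV. ennreal_powr (choquet_maximal C f x) p > ennreal \<tau>}
        \<le> (\<Sum>k. ennreal (2 * K * 2 ^ k) * C {x. 2 ^ k / 2 * t < \<bar>f x\<bar>})"
      by (intro order_trans[OF mono weak_type_layers[OF K t weak]])
    also have "\<dots> \<le> (\<Sum>k. ennreal (2 * K * 2 ^ k) * H (c k * \<tau>))"
    proof (intro suminf_le mult_left_mono)
      fix k :: nat
      have eq: "(c k * \<tau>) powr (1 / p) = 2 ^ k / 2 * t"
        using p \<tau> by (simp add: c_def t_def powr_mult powr_powr)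
      show "C {x. 2 ^ k / 2 * t < \<bar>f x\<bar>} \<le> H (c k * \<tau>)"
        unfolding H_def
      proof (intro mono subsetI CollectI conjI UNIV_I)
        fix x assume "x \<in> {x. 2 ^ k / 2 * t < \<bar>f x\<bar>}"
        then have "c k * \<tau> < \<bar>f x\<bar> powr p"
          using c_pos[of k] \<tau> by (intro powr_less) (auto simp: eq)
        then show "ennreal (c k * \<tau>) < ennreal (\<bar>f x\<bar> powr p)"
          using c_pos[of k] \<tau> by (simp add: ennreal_less_iff)
      qed
    qed auto
    finally show ?thesis .
  qed
  have scale: "(\<integral>\<^sup>+\<tau>. H (c k * \<tau>) * indicator {0<..} \<tau> \<partial>lborel) = ennreal (1 / c k) * I" for k
  proof -
    have "I = ennreal (c k) * (\<integral>\<^sup>+\<tau>. H (c k * \<tau>) * indicator {0<..} (c k * \<tau>) \<partial>lborel)"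
      unfolding I using nn_integral_real_affine[of "\<lambda>\<tau>. H \<tau> * indicator {0<..} \<tau>" "c k" 0] c_pos[of k]
      by simp
    also have "(\<lambda>\<tau>. H (c k * \<tau>) * indicator {0<..} (c k * \<tau>)) = (\<lambda>\<tau>. H (c k * \<tau>) * indicator {0<..} \<tau>)"
      using c_pos[of k] by (auto simp: fun_eq_iff zero_less_mult_iff split: split_indicator)
    finally have "ennreal (1 / c k) * I
        = ennreal (1 / c k) * ennreal (c k) * (\<integral>\<^sup>+\<tau>. H (c k * \<tau>) * indicator {0<..} \<tau> \<partial>lborel)"
      by (simp add: mult.assoc)
    also have "ennreal (1 / c k) * ennreal (c k) = 1"
      using c_pos[of k] by (simp flip: ennreal_mult)
    finally show ?thesis by simp
  qed
  \<comment> \<open>The weight \<open>2 ^ k\<close> against the dilation factor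
    \<open>1 / c k\<close> leaves \<open>2 powr p * q ^ k\<close>, a convergent geometric series
    because \<open>p > 1\<close>.\<close>
  define q where "q = (2 :: real) powr (1 - p)"
  have q: "0 < q" "q < 1" using p by (simp_all add: q_def powr_less_one)
  have coeff: "2 * K * 2 ^ k * (1 / c k) = 2 * K * 2 powr p * q ^ k" for k
  proof -
    have "c k = 2 powr (real k * p) / 2 powr p"
      by (simp add: c_def powr_divide powr_powr flip: powr_realpow)
    moreover have "q ^ k = 2 powr (real k) / 2 powr (real k * p)"
      by (simp add: q_def powr_diff[symmetric] powr_powr algebra_simps flip: powr_realpow)
    ultimately show ?thesis by (simp add: powr_realpow)
  qed
  have "choquet_integral C UNIV (\<lambda>x. ennreal_powr (choquet_maximal C f x) p)
      \<le> (\<integral>\<^sup>+\<tau>. (\<Sum>k. ennreal (2 * K * 2 ^ k) * (H (c k * \<tau>) * indicator {0<..} \<tau>)) \<partial>lborel)"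
    unfolding choquet_integral_def using level
    by (intro nn_integral_mono) (simp split: split_indicator)
  also have "\<dots> = (\<Sum>k. ennreal (2 * K * 2 ^ k) * (\<integral>\<^sup>+\<tau>. H (c k * \<tau>) * indicator {0<..} \<tau> \<partial>lborel))"
    by (subst nn_integral_suminf) (auto simp: nn_integral_cmult)
  also have "\<dots> = (\<Sum>k. ennreal (2 * K * 2 powr p * q ^ k) * I)"
    unfolding scale
  proof (rule suminf_cong)
    fix k
    have "ennreal (2 * K * 2 ^ k) * ennreal (1 / c k) = ennreal (2 * K * 2 powr p * q ^ k)"
      unfolding coeff[symmetric] using K c_pos[of k] by (intro ennreal_mult[symmetric]) auto
    then show "ennreal (2 * K * 2 ^ k) * (ennreal (1 / c k) * I) = ennreal (2 * K * 2 powr p * q ^ k) * I"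
      by (simp add: mult.assoc[symmetric])
  qed
  also have "\<dots> = (\<Sum>k. ennreal (2 * K * 2 powr p * q ^ k)) * I"
    by simp
  also have "(\<Sum>k. ennreal (2 * K * 2 powr p * q ^ k)) = ennreal (2 * K * 2 powr p / (1 - q))"
  proof (rule suminf_ennreal_eq)
    show "(\<lambda>k. 2 * K * 2 powr p * q ^ k) sums (2 * K * 2 powr p / (1 - q))"
      using sums_mult[OF geometric_sums[of q], of "2 * K * 2 powr p"] q by simp
  qed (use K q in auto)
  finally show ?thesis unfolding I_def q_def .
qed

end

subsection \<open>The maximal theorem\<close>

theorem theorem1:
  fixes C :: "(real ^ 'n) set \<Rightarrow> ennreal" and xQ :: "real ^ 'n" and l :: real
  assumes "l > 0"
    and "outer_capacity C"
    and "packing_assumption xQ l C"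
    and "doubling_capacity C"
  shows "(\<exists>K::real. K > 0 \<and>
            (\<forall>(f :: real ^ 'n \<Rightarrow> real) t::real. t > 0 \<longrightarrow>
               C {x. choquet_maximal C f x > ennreal t}
                 \<le> ennreal (K / t) * choquet_integral C UNIV (\<lambda>x. ennreal \<bar>f x\<bar>)))
       \<and> (\<forall>p::real. 1 < p \<longrightarrow>
            (\<exists>K::real. K > 0 \<and>
              (\<forall>f :: real ^ 'n \<Rightarrow> real.
                 choquet_integral C UNIV (\<lambda>x. ennreal_powr (choquet_maximal C f x) p)
                   \<le> ennreal K * choquet_integral C UNIV (\<lambda>x. ennreal (\<bar>f x\<bar> powr p)))))"
proof -
  interpret outer_cap C by unfold_locales (fact assms)
  obtain D where D: "D > 0" "\<And>x r. r > 0 \<Longrightarrow> C (ball x (2 * r)) \<le> ennreal D * C (ball x r)"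
    using assms(4) unfolding doubling_capacity_def by blast
  \<comment> \<open>Raised to at least 1, so that its powers are constants of the form required by
    \<open>ball_scale\<close>.\<close>
  define D0 where "D0 = max D 1"
  interpret doubling_outer_cap C D0
  proof
    show "C (ball x (2 * r)) \<le> ennreal D0 * C (ball x r)" if "r > 0" for x r
      using D(2)[OF that, of x] mult_right_mono[of "ennreal D" "ennreal D0" "C (ball x r)"]
      by (auto simp: D0_def ennreal_leI)
  qed (simp add: D0_def)
  obtain K where K: "K > 0"
    "\<And>f t. t > 0 \<Longrightarrow> C {x. choquet_maximal C f x > ennreal t}
       \<le> ennreal (K / t) * choquet_integral C UNIV (\<lambda>x. ennreal \<bar>f x\<bar>)"
  proof (cases "\<exists>x0 r0. r0 > 0 \<and> (C (ball x0 r0) = 0 \<or> C (ball x0 r0) = \<infinity>)")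
    case True
    \<comment> \<open>All superlevel sets are then empty and any constant serves.\<close>
    then have "choquet_maximal C f x = 0" for f x using degenerate_balls by blast
    then show ?thesis using that[of 1] by simp
  next
    case False
    from assms(3) obtain A0 where A0: "A0 \<ge> 1" and pack:
      "\<forall>Q' \<in> dyadic_cubes xQ l. \<forall>F. F \<subseteq> dyadic_cubes xQ l \<and> non_overlapping F \<and>
         (\<forall>R \<in> F. R \<subseteq> Q') \<and> (\<Sum>\<^sub>\<infinity>R\<in>F. C R) \<le> ennreal A0 * C Q' \<longrightarrow>
         (\<forall>f :: real ^ 'n \<Rightarrow> ennreal.
           (\<Sum>\<^sub>\<infinity>R\<in>F. choquet_integral C R f) \<le> ennreal A0 * choquet_integral C (\<Union>F) f)"
      unfolding packing_assumption_def by (elim exE conjE)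
    interpret packing_capacity C D0 xQ l A0
    proof
      show "l > 0" "A0 \<ge> 1" by fact+
      show "(\<Sum>R\<in>F. choquet_integral C R f) \<le> ennreal A0 * choquet_integral C (\<Union>F) f"
        if "Q' \<in> dyadic_cubes xQ l" "finite F" "F \<subseteq> dyadic_cubes xQ l" "non_overlapping F"
          "\<And>R. R \<in> F \<Longrightarrow> R \<subseteq> Q'" "sum C F \<le> ennreal A0 * C Q'" for Q' F f
        using pack[rule_format, OF that(1), of F f] that by simp
      show "C (ball x r) \<noteq> 0" "C (ball x r) < \<infinity>" if "r > 0" for x r
        using False that by (auto simp flip: less_top)
    qed
    show ?thesis using weak_type that by blast
  qed
  have "\<exists>K>0. \<forall>f. choquet_integral C UNIV (\<lambda>x. ennreal_powr (choquet_maximal C f x) p)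
      \<le> ennreal K * choquet_integral C UNIV (\<lambda>x. ennreal (\<bar>f x\<bar> powr p))" if p: "p > 1" for p
  proof (intro exI conjI allI)
    have "2 powr (1 - p) < 1" using p by (simp add: powr_less_one)
    then show "2 * K * 2 powr p / (1 - 2 powr (1 - p)) > 0" using K(1) by simp
  qed (rule strong_type_of_weak_type[OF K(1) p K(2)])
  with K show ?thesis by blast
qed

end
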